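(* Using the following algorithm, the task FindSep (given an ancestral graph $G=(V,E)$ with $n$ nodes and $m$ edges, pairwise disjoint sets $X,Y,R\subseteq V$ with $X,Y$ non-empty, and a set $I\subseteq R$, output a set $Z$ with $I\subseteq Z\subseteq R$ that $m$-separates $X$ and $Y$ in $G$, or $\bot$ if no such set exists) can be solved in time $O(n+m)$. Algorithm FindSep$(G,X,Y,I,R)$: Let $R'=R\setminus(X\cup Y)$ and $Z=Ant(X\cup Y\cup I)\cap R'$. If TestSep$(G,X,Y,Z)$ returns true, return $Z$; otherwise return $\bot$.
   Context: A mixed graph has directed ($A\to B$), undirected ($A-B$) and bidirected ($A\leftrightarrow B$) edges. A path is a sequence of distinct nodes with consecutive nodes adjacent; adjacent nodes are neighbors. $U$ is an ancestor of $W$ if there is a directed path $U\to\cdots\to W$; $U$ is an anterior of $W$ if there is a path from $U$ to $W$ that becomes directed after replacing each undirected edge $S-T$ on it (traversed from $S$ to $T$) by $S\to T$. Every node is its own ancestor and anterior; $An(S)$ and $Ant(S)$ are the sets of ancestors and anteriors of nodes of $S$. A mixed graph is an ancestral graph if (1) for each edge $A\gets B$ or $A\leftrightarrow B$, $A$ is not an anterior of $B$, and (2) for each edge $A-B$ there are no edges $A\gets C$, $A\leftrightarrow C$, $B\gets C$ or $B\leftrightarrow C$. (Hence there is at most one edge between two nodes; DAGs are ancestral graphs.) A node on a path is a collider if two arrowheads of the path meet at it. Nodes $U,W$ are $m$-connected by $Z$ if there is a path between them on which every collider is in $An(Z)$ and every non-collider is not in $Z$; otherwise $Z$ $m$-separates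 $U$ and $W$. $Z$ $m$-separates sets $X,Y$ if it $m$-separates every $U\in X$ from every $W\in Y$. TestSep$(G,X,Y,Z)$ is the following procedure, which decides whether $Z$ $m$-separates $X$ and $Y$: let $P=\{(\gets,x):x\in X\}$ and $Q=P$. While $P$ is not empty: remove a pair $(e,T)$ from $P$; for every neighbor $N$ of $T$, with $f$ the edge between $T$ and $N$ (type read from $T$ to $N$), if $e,T,f$ is $m$-connecting and $(f,N)\notin Q$, add $(f,N)$ to $P$ and $Q$; then, if $T\in Y$, return false. When $P$ is empty, return true. Here $e$ is an edge type read in the direction in which $T$ is entered, and $e,T,f$ is $m$-connecting if either $T\notin Z$ and $e,f$ do not both have an arrowhead at $T$, or $T\in Z$ and both have an arrowhead at $T$ ($f$ may be the edge through which $T$ was entered). *)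

theory Defs
  imports Main
begin

section \<open>Mixed graphs\<close>

text \<open>
  An edge type is read from the first node to the second:
  \<open>To\<close> is \<open>\<rightarrow>\<close>, \<open>From\<close> is \<open>\<leftarrow>\<close>, \<open>Undir\<close> is \<open>\<midarrow>\<close> and \<open>Bidir\<close> is \<open>\<leftrightarrow>\<close>.
\<close>

datatype edge_type = To | From | Undir | Bidir

record 'v mixed_graph =
  verts :: "'v set"
  directed :: "('v \<times> 'v) set"
  undirected :: "'v set set"
  bidirected :: "'v set set"

definition mixed_graph :: "'v mixed_graph \<Rightarrow> bool" where
  "mixed_graph G \<longleftrightarrow>
     finite (verts G) \<and>
     (\<forall>(u, v) \<in> directed G. u \<in> verts G \<and> v \<in> verts G \<and> u \<noteq> v) \<and>
     (\<forall>e \<in> undirected G \<union> bidirected G. e \<subseteq> verts G \<and> card e = 2)"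

definition num_edges :: "'v mixed_graph \<Rightarrow> nat" where
  "num_edges G = card (directed G) + card (undirected G) + card (bidirected G)"

fun edge :: "'v mixed_graph \<Rightarrow> 'v \<Rightarrow> edge_type \<Rightarrow> 'v \<Rightarrow> bool" where
  "edge G u To v = ((u, v) \<in> directed G)"
| "edge G u From v = ((v, u) \<in> directed G)"
| "edge G u Undir v = ({u, v} \<in> undirected G)"
| "edge G u Bidir v = ({u, v} \<in> bidirected G)"

definition adjacent :: "'v mixed_graph \<Rightarrow> 'v \<Rightarrow> 'v \<Rightarrow> bool" where
  "adjacent G u v \<longleftrightarrow> (\<exists>t. edge G u t v)"

definition path :: "'v mixed_graph \<Rightarrow> 'v list \<Rightarrow> bool" where
  "path G p \<longleftrightarrow> p \<noteq> [] \<and> set p \<subseteq> verts G \<and> distinct p \<and> successively (adjacent G) p"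

definition path_between :: "'v mixed_graph \<Rightarrow> 'v \<Rightarrow> 'v list \<Rightarrow> 'v \<Rightarrow> bool" where
  "path_between G u p w \<longleftrightarrow> path G p \<and> hd p = u \<and> last p = w"

definition ancestor :: "'v mixed_graph \<Rightarrow> 'v \<Rightarrow> 'v \<Rightarrow> bool" where
  "ancestor G u w \<longleftrightarrow>
     (\<exists>p. path_between G u p w \<and> successively (\<lambda>a b. edge G a To b) p)"

definition anterior :: "'v mixed_graph \<Rightarrow> 'v \<Rightarrow> 'v \<Rightarrow> bool" where
  "anterior G u w \<longleftrightarrow>
     (\<exists>p. path_between G u p w \<and> successively (\<lambda>a b. edge G a To b \<or> edge G a Undir b) p)"

definition An :: "'v mixed_graph \<Rightarrow> 'v set \<Rightarrow> 'v set" where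
  "An G S = {u. \<exists>w \<in> S. ancestor G u w}"

definition Ant :: "'v mixed_graph \<Rightarrow> 'v set \<Rightarrow> 'v set" where
  "Ant G S = {u. \<exists>w \<in> S. anterior G u w}"

definition ancestral_graph :: "'v mixed_graph \<Rightarrow> bool" where
  "ancestral_graph G \<longleftrightarrow>
     mixed_graph G \<and>
     (\<forall>a b. edge G a From b \<or> edge G a Bidir b \<longrightarrow> \<not> anterior G a b) \<and>
     (\<forall>a b. edge G a Undir b \<longrightarrow>
        (\<nexists>c. edge G a From c \<or> edge G a Bidir c \<or> edge G b From c \<or> edge G b Bidir c))"


section \<open>m-separation\<close>

text \<open>
  Paths are node sequences, so \<open>collider\<close> refers to the edge between consecutive nodes;
  this is unambiguous in ancestral graphs, which have at most one edge between two nodes.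
  The end nodes of a path are non-colliders.
\<close>

definition arrowhead_at :: "'v mixed_graph \<Rightarrow> 'v \<Rightarrow> 'v \<Rightarrow> bool" where
  "arrowhead_at G u v \<longleftrightarrow> edge G u To v \<or> edge G u Bidir v"

definition collider :: "'v mixed_graph \<Rightarrow> 'v list \<Rightarrow> nat \<Rightarrow> bool" where
  "collider G p i \<longleftrightarrow> 0 < i \<and> Suc i < length p \<and>
     arrowhead_at G (p ! (i - 1)) (p ! i) \<and> arrowhead_at G (p ! Suc i) (p ! i)"

definition m_connected :: "'v mixed_graph \<Rightarrow> 'v set \<Rightarrow> 'v \<Rightarrow> 'v \<Rightarrow> bool" where
  "m_connected G Z u w \<longleftrightarrow>
     (\<exists>p. path_between G u p w \<and>
       (\<forall>i < length p. if collider G p i then p ! i \<in> An G Z else p ! i \<notin> Z))"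

definition m_separates :: "'v mixed_graph \<Rightarrow> 'v set \<Rightarrow> 'v set \<Rightarrow> 'v set \<Rightarrow> bool" where
  "m_separates G Z X Y \<longleftrightarrow> (\<forall>u \<in> X. \<forall>w \<in> Y. \<not> m_connected G Z u w)"


section \<open>The task and the algorithm\<close>

definition find_sep_instance ::
    "'v mixed_graph \<Rightarrow> 'v set \<Rightarrow> 'v set \<Rightarrow> 'v set \<Rightarrow> 'v set \<Rightarrow> bool" where
  "find_sep_instance G X Y I R \<longleftrightarrow>
     ancestral_graph G \<and>
     X \<subseteq> verts G \<and> Y \<subseteq> verts G \<and> R \<subseteq> verts G \<and>
     X \<inter> Y = {} \<and> X \<inter> R = {} \<and> Y \<inter> R = {} \<and>
     X \<noteq> {} \<and> Y \<noteq> {} \<and> I \<subseteq> R"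

text \<open>The value \<open>None\<close> stands for the answer \<open>\<bottom>\<close>.\<close>

definition find_sep_solution ::
    "'v mixed_graph \<Rightarrow> 'v set \<Rightarrow> 'v set \<Rightarrow> 'v set \<Rightarrow> 'v set \<Rightarrow> 'v set option \<Rightarrow> bool" where
  "find_sep_solution G X Y I R r \<longleftrightarrow>
     (case r of
        Some Z \<Rightarrow> I \<subseteq> Z \<and> Z \<subseteq> R \<and> m_separates G Z X Y
      | None \<Rightarrow> \<not> (\<exists>Z. I \<subseteq> Z \<and> Z \<subseteq> R \<and> m_separates G Z X Y))"

definition head_at_end :: "edge_type \<Rightarrow> bool" where
  "head_at_end e \<longleftrightarrow> e = To \<or> e = Bidir"

definition head_at_start :: "edge_type \<Rightarrow> bool" where
  "head_at_start f \<longleftrightarrow> f = From \<or> f = Bidir"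

definition m_connecting :: "'v set \<Rightarrow> edge_type \<Rightarrow> 'v \<Rightarrow> edge_type \<Rightarrow> bool" where
  "m_connecting Z e T f \<longleftrightarrow>
     (T \<notin> Z \<and> \<not> (head_at_end e \<and> head_at_start f)) \<or>
     (T \<in> Z \<and> head_at_end e \<and> head_at_start f)"

definition new_pairs ::
    "'v mixed_graph \<Rightarrow> 'v set \<Rightarrow> (edge_type \<times> 'v) set \<Rightarrow> edge_type \<Rightarrow> 'v
      \<Rightarrow> (edge_type \<times> 'v) set" where
  "new_pairs G Z Q e T = {(f, N). edge G T f N \<and> m_connecting Z e T f \<and> (f, N) \<notin> Q}"

text \<open>
  \<open>test_sep_loop G Y Z P Q b\<close>: some execution of the loop of TestSep from the worklist \<open>P\<close> and
  the set \<open>Q\<close> of pairs seen so far returns \<open>b\<close>.  The pair that is removed from \<open>P\<close> is arbitrary.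
\<close>

inductive test_sep_loop ::
    "'v mixed_graph \<Rightarrow> 'v set \<Rightarrow> 'v set \<Rightarrow> (edge_type \<times> 'v) set \<Rightarrow> (edge_type \<times> 'v) set
      \<Rightarrow> bool \<Rightarrow> bool"
  for G Y Z where
  finished: "test_sep_loop G Y Z {} Q True"
| found: "(e, T) \<in> P \<Longrightarrow> T \<in> Y \<Longrightarrow> test_sep_loop G Y Z P Q False"
| continue: "(e, T) \<in> P \<Longrightarrow> T \<notin> Y \<Longrightarrow>
    test_sep_loop G Y Z (P - {(e, T)} \<union> new_pairs G Z Q e T) (Q \<union> new_pairs G Z Q e T) b \<Longrightarrow>
    test_sep_loop G Y Z P Q b"

definition test_sep ::
    "'v mixed_graph \<Rightarrow> 'v set \<Rightarrow> 'v set \<Rightarrow> 'v set \<Rightarrow> bool \<Rightarrow> bool" where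
  "test_sep G X Y Z b \<longleftrightarrow> test_sep_loop G Y Z ({From} \<times> X) ({From} \<times> X) b"

definition find_sep ::
    "'v mixed_graph \<Rightarrow> 'v set \<Rightarrow> 'v set \<Rightarrow> 'v set \<Rightarrow> 'v set \<Rightarrow> 'v set option \<Rightarrow> bool" where
  "find_sep G X Y I R r \<longleftrightarrow>
     (let R' = R - (X \<union> Y); Z = Ant G (X \<union> Y \<union> I) \<inter> R'
      in \<exists>b. test_sep G X Y Z b \<and> r = (if b then Some Z else None))"


section \<open>A random access machine with a step count\<close>

text \<open>
  Programs work on registers and arrays of natural numbers, with addition, truncated subtraction
  and comparison as the only operations on numbers.  The running time counts every operation,
  every register or array access, every constant and every command that is executed.
\<close>

datatype ('r, 'a) aexp =
    Const nat
  | Reg 'r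
  | Arr 'a "('r, 'a) aexp"
  | Add "('r, 'a) aexp" "('r, 'a) aexp"
  | Sub "('r, 'a) aexp" "('r, 'a) aexp"

datatype ('r, 'a) bexp =
    Eq "('r, 'a) aexp" "('r, 'a) aexp"
  | Less "('r, 'a) aexp" "('r, 'a) aexp"
  | Neg "('r, 'a) bexp"
  | And "('r, 'a) bexp" "('r, 'a) bexp"
  | Or "('r, 'a) bexp" "('r, 'a) bexp"

datatype ('r, 'a) com =
    Skip
  | Assign 'r "('r, 'a) aexp"
  | Store 'a "('r, 'a) aexp" "('r, 'a) aexp"
  | Seq "('r, 'a) com" "('r, 'a) com"  (infixr \<open>;;\<close> 60)
  | Cond "('r, 'a) bexp" "('r, 'a) com" "('r, 'a) com"
  | While "('r, 'a) bexp" "('r, 'a) com"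

record ('r, 'a) state =
  reg :: "'r \<Rightarrow> nat"
  arr :: "'a \<Rightarrow> nat \<Rightarrow> nat"

primrec aval :: "('r, 'a) aexp \<Rightarrow> ('r, 'a) state \<Rightarrow> nat" where
  "aval (Const c) s = c"
| "aval (Reg x) s = reg s x"
| "aval (Arr a e) s = arr s a (aval e s)"
| "aval (Add e1 e2) s = aval e1 s + aval e2 s"
| "aval (Sub e1 e2) s = aval e1 s - aval e2 s"

primrec acost :: "('r, 'a) aexp \<Rightarrow> nat" where
  "acost (Const c) = 1"
| "acost (Reg x) = 1"
| "acost (Arr a e) = 1 + acost e"
| "acost (Add e1 e2) = 1 + acost e1 + acost e2"
| "acost (Sub e1 e2) = 1 + acost e1 + acost e2"

primrec bval :: "('r, 'a) bexp \<Rightarrow> ('r, 'a) state \<Rightarrow> bool" where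
  "bval (Eq e1 e2) s = (aval e1 s = aval e2 s)"
| "bval (Less e1 e2) s = (aval e1 s < aval e2 s)"
| "bval (Neg b) s = (\<not> bval b s)"
| "bval (And b1 b2) s = (bval b1 s \<and> bval b2 s)"
| "bval (Or b1 b2) s = (bval b1 s \<or> bval b2 s)"

primrec bcost :: "('r, 'a) bexp \<Rightarrow> nat" where
  "bcost (Eq e1 e2) = 1 + acost e1 + acost e2"
| "bcost (Less e1 e2) = 1 + acost e1 + acost e2"
| "bcost (Neg b) = 1 + bcost b"
| "bcost (And b1 b2) = 1 + bcost b1 + bcost b2"
| "bcost (Or b1 b2) = 1 + bcost b1 + bcost b2"

text \<open>\<open>exec c s t s'\<close>: started in \<open>s\<close>, program \<open>c\<close> halts in \<open>s'\<close> after time \<open>t\<close>.\<close>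

inductive exec ::
    "('r, 'a) com \<Rightarrow> ('r, 'a) state \<Rightarrow> nat \<Rightarrow> ('r, 'a) state \<Rightarrow> bool" where
  Skip: "exec Skip s 1 s"
| Assign: "exec (Assign x e) s (1 + acost e) (s\<lparr>reg := (reg s)(x := aval e s)\<rparr>)"
| Store: "exec (Store a i e) s (1 + acost i + acost e)
    (s\<lparr>arr := (arr s)(a := (arr s a)(aval i s := aval e s))\<rparr>)"
| Seq: "exec c1 s t1 s' \<Longrightarrow> exec c2 s' t2 s'' \<Longrightarrow> exec (c1 ;; c2) s (t1 + t2) s''"
| Cond_true: "bval b s \<Longrightarrow> exec c1 s t s' \<Longrightarrow> exec (Cond b c1 c2) s (1 + bcost b + t) s'"
| Cond_false: "\<not> bval b s \<Longrightarrow> exec c2 s t s' \<Longrightarrow> exec (Cond b c1 c2) s (1 + bcost b + t) s'"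
| While_true: "bval b s \<Longrightarrow> exec c s t1 s' \<Longrightarrow> exec (While b c) s' t2 s'' \<Longrightarrow>
    exec (While b c) s (1 + bcost b + t1 + t2) s''"
| While_false: "\<not> bval b s \<Longrightarrow> exec (While b c) s (1 + bcost b) s"

lemma exec_deterministic:
  "exec c s t s' \<Longrightarrow> exec c s u s'' \<Longrightarrow> t = u \<and> s' = s''"
proof (induction arbitrary: u s'' rule: exec.induct)
  case (Seq c1 s t1 s1 c2 t2 s2)
  from Seq.prems show ?case
    by (cases rule: exec.cases) (use Seq.IH in blast)
next
  case (While_true b s c t1 s1 t2 s2)
  from While_true.prems show ?case
    by (cases rule: exec.cases) (use While_true in blast)+
next
  case (Cond_true b s c1 t s1 c2)
  from Cond_true.prems show ?case
    by (cases rule: exec.cases) (use Cond_true in blast)+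
next
  case (Cond_false b s c2 t s1 c1)
  from Cond_false.prems show ?case
    by (cases rule: exec.cases) (use Cond_false in blast)+
qed (erule exec.cases; simp)+


section \<open>The algorithm as a machine program\<close>

datatype register = rN | rI | rK | rTop | rT | rE | rF | rNb | rAns

datatype array =
  aOff | aNbr | aTyp | aX | aY | aI | aR | aAnt | aZ | aStack | aPE | aPT | aQ

type_synonym program = "(register, array) com"

abbreviation set_reg :: "register \<Rightarrow> (register, array) aexp \<Rightarrow> program"
    (infix \<open>::=\<close> 65) where
  "x ::= e \<equiv> Assign x e"

abbreviation inc :: "register \<Rightarrow> program" where
  "inc x \<equiv> x ::= Add (Reg x) (Const 1)"

abbreviation dec :: "register \<Rightarrow> program" where
  "dec x \<equiv> x ::= Sub (Reg x) (Const 1)"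

abbreviation is_set :: "array \<Rightarrow> register \<Rightarrow> (register, array) bexp" where
  "is_set a x \<equiv> Eq (Arr a (Reg x)) (Const 1)"

text \<open>\<open>for_nodes c\<close> runs \<open>c\<close> with \<open>rI\<close> ranging over the nodes; \<open>for_neighbors c\<close> runs \<open>c\<close> with
  \<open>rK\<close> ranging over the adjacency list entries of the node \<open>rT\<close>.\<close>

definition for_nodes :: "program \<Rightarrow> program" where
  "for_nodes c =
     rI ::= Const 0 ;;
     While (Less (Reg rI) (Reg rN)) (c ;; inc rI)"

definition for_neighbors :: "program \<Rightarrow> program" where
  "for_neighbors c =
     rK ::= Arr aOff (Reg rT) ;;
     While (Less (Reg rK) (Arr aOff (Add (Reg rT) (Const 1)))) (c ;; inc rK)"

primrec type_code :: "edge_type \<Rightarrow> nat" where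
  "type_code To = 0"
| "type_code From = 1"
| "type_code Undir = 2"
| "type_code Bidir = 3"

abbreviation has_type :: "register \<Rightarrow> edge_type \<Rightarrow> (register, array) bexp" where
  "has_type x t \<equiv> Eq (Reg x) (Const (type_code t))"

text \<open>\<open>anteriors_program\<close> marks \<open>Ant (X \<union> Y \<union> I)\<close> in \<open>aAnt\<close> by a backward search.\<close>

definition anteriors_program :: program where
  "anteriors_program =
     rTop ::= Const 0 ;;
     for_nodes
       (Cond (Or (is_set aX rI) (Or (is_set aY rI) (is_set aI rI)))
          (Store aAnt (Reg rI) (Const 1) ;;
           Store aStack (Reg rTop) (Reg rI) ;;
           inc rTop)
          (Store aAnt (Reg rI) (Const 0))) ;;
     While (Less (Const 0) (Reg rTop))
       (dec rTop ;;
        rT ::= Arr aStack (Reg rTop) ;;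
        for_neighbors
          (rF ::= Arr aTyp (Reg rK) ;;
           rNb ::= Arr aNbr (Reg rK) ;;
           Cond (And (Or (has_type rF From) (has_type rF Undir)) (Neg (is_set aAnt rNb)))
             (Store aAnt (Reg rNb) (Const 1) ;;
              Store aStack (Reg rTop) (Reg rNb) ;;
              inc rTop)
             Skip))"

definition separator_program :: program where
  "separator_program =
     for_nodes
       (Cond (And (is_set aAnt rI)
                (And (is_set aR rI) (Neg (Or (is_set aX rI) (is_set aY rI)))))
          (Store aZ (Reg rI) (Const 1))
          (Store aZ (Reg rI) (Const 0)))"

text \<open>The worklist \<open>P\<close> is a stack kept in \<open>aPE\<close> and \<open>aPT\<close>; the pair \<open>(e, T)\<close> belongs to \<open>Q\<close>
  iff \<open>aQ\<close> holds 1 at index \<open>4 * T + type_code e\<close>.\<close>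

abbreviation pair_index :: "register \<Rightarrow> (register, array) aexp \<Rightarrow> (register, array) aexp" where
  "pair_index x e \<equiv> Add (Add (Add (Reg x) (Reg x)) (Add (Reg x) (Reg x))) e"

definition m_connecting_test :: "(register, array) bexp" where
  "m_connecting_test =
     (let both = And (Or (has_type rE To) (has_type rE Bidir))
                     (Or (has_type rF From) (has_type rF Bidir))
      in Or (And (Neg (is_set aZ rT)) (Neg both)) (And (is_set aZ rT) both))"

definition test_sep_program :: program where
  "test_sep_program =
     rAns ::= Const 1 ;;
     rTop ::= Const 0 ;;
     for_nodes
       (Store aQ (pair_index rI (Const (type_code To))) (Const 0) ;;
        Store aQ (pair_index rI (Const (type_code From))) (Const 0) ;;
        Store aQ (pair_index rI (Const (type_code Undir))) (Const 0) ;;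
        Store aQ (pair_index rI (Const (type_code Bidir))) (Const 0) ;;
        Cond (is_set aX rI)
          (Store aPE (Reg rTop) (Const (type_code From)) ;;
           Store aPT (Reg rTop) (Reg rI) ;;
           inc rTop ;;
           Store aQ (pair_index rI (Const (type_code From))) (Const 1))
          Skip) ;;
     While (And (Less (Const 0) (Reg rTop)) (Eq (Reg rAns) (Const 1)))
       (dec rTop ;;
        rE ::= Arr aPE (Reg rTop) ;;
        rT ::= Arr aPT (Reg rTop) ;;
        for_neighbors
          (rF ::= Arr aTyp (Reg rK) ;;
           rNb ::= Arr aNbr (Reg rK) ;;
           Cond (And m_connecting_test (Neg (Eq (Arr aQ (pair_index rNb (Reg rF))) (Const 1))))
             (Store aPE (Reg rTop) (Reg rF) ;;
              Store aPT (Reg rTop) (Reg rNb) ;;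
              inc rTop ;;
              Store aQ (pair_index rNb (Reg rF)) (Const 1))
             Skip) ;;
        Cond (is_set aY rT) (rAns ::= Const 0) Skip)"

definition find_sep_program :: program where
  "find_sep_program = anteriors_program ;; separator_program ;; test_sep_program"


section \<open>Representation of inputs and outputs\<close>

text \<open>
  The nodes are numbered by \<open>\<nu>\<close>.  The graph is given by adjacency lists stored in one array:
  the entries at the indices from \<open>aOff i\<close> to \<open>aOff (i + 1) - 1\<close> list each edge at node \<open>\<nu> i\<close>
  exactly once, with its type read from \<open>\<nu> i\<close>.  Sets of nodes are 0/1 vectors.
  All other registers and memory cells may hold arbitrary values initially.
\<close>

definition encodes_set ::
    "'v mixed_graph \<Rightarrow> (nat \<Rightarrow> 'v) \<Rightarrow> (nat \<Rightarrow> nat) \<Rightarrow> 'v set \<Rightarrow> bool" where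
  "encodes_set G \<nu> a S \<longleftrightarrow> (\<forall>i < card (verts G). a i = (if \<nu> i \<in> S then 1 else 0))"

definition encodes_graph ::
    "'v mixed_graph \<Rightarrow> (nat \<Rightarrow> 'v) \<Rightarrow> (register, array) state \<Rightarrow> bool" where
  "encodes_graph G \<nu> s \<longleftrightarrow>
     bij_betw \<nu> {..<card (verts G)} (verts G) \<and>
     reg s rN = card (verts G) \<and>
     (\<forall>i < card (verts G).
        arr s aOff i \<le> arr s aOff (i + 1) \<and>
        bij_betw (\<lambda>k. (arr s aTyp k, arr s aNbr k)) {arr s aOff i..<arr s aOff (i + 1)}
          {(type_code t, j) | t j. j < card (verts G) \<and> edge G (\<nu> i) t (\<nu> j)})"

definition encodes_input ::
    "'v mixed_graph \<Rightarrow> 'v set \<Rightarrow> 'v set \<Rightarrow> 'v set \<Rightarrow> 'v set \<Rightarrow> (nat \<Rightarrow> 'v)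
      \<Rightarrow> (register, array) state \<Rightarrow> bool" where
  "encodes_input G X Y I R \<nu> s \<longleftrightarrow>
     encodes_graph G \<nu> s \<and>
     encodes_set G \<nu> (arr s aX) X \<and> encodes_set G \<nu> (arr s aY) Y \<and>
     encodes_set G \<nu> (arr s aI) I \<and> encodes_set G \<nu> (arr s aR) R"

definition encodes_output ::
    "'v mixed_graph \<Rightarrow> (nat \<Rightarrow> 'v) \<Rightarrow> (register, array) state \<Rightarrow> 'v set option \<Rightarrow> bool" where
  "encodes_output G \<nu> s r \<longleftrightarrow>
     (case r of
        Some Z \<Rightarrow> reg s rAns = 1 \<and> encodes_set G \<nu> (arr s aZ) Z
      | None \<Rightarrow> reg s rAns = 0)"

end

theory Submission
  imports Defs
begin

text \<open>
  Paths are replaced by walks whose states are pairs of a node and the edge through which it was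
  entered; the nodes of \<open>X\<close> start with an artificial tail.  In an ancestral graph a loop can be cut
  out of an open walk: if this turns a node into a collider, the loop left it along a directed path,
  which cannot return and hence meets a collider in \<open>An Z\<close>.  So TestSep decides m-separation.

  All nodes of a walk from \<open>X\<close> to \<open>Y\<close> that is open for \<open>Ant (X \<union> Y \<union> I) \<inter> R\<close> are anteriors of
  \<open>X \<union> Y \<union> I\<close>, so its non-colliders lie outside \<open>R\<close> and hence outside every candidate \<open>Z\<close>; a collider
  that is not in \<open>An Z\<close> is an ancestor of \<open>X\<close> or \<open>Y\<close> by a directed path avoiding \<open>Z\<close>, along which the
  walk can be rerouted.  Thus no \<open>Z\<close> separates if this one does not.

  The running time is amortized: a node (in the first search) or a pair (in TestSep) pays for
  its adjacency list when it is removed from the stack, which happens at most once.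
\<close>

section \<open>Walks and TestSep\<close>

text \<open>The obstacle is that m-connection speaks of paths with distinct nodes and of colliders
  in \<open>An G Z\<close>, while TestSep repeats nodes freely and admits only colliders in
  \<open>Z\<close>. The parameters of \<open>walk_step\<close> isolate the second difference:
  \<open>C\<close> holds the admissible colliders, \<open>Z\<close> the forbidden non-colliders.
  \<open>C = Z\<close> is TestSep, \<open>C = An G Z\<close> is m-connection, and detours down to
  \<open>Z\<close> and back identify the two. The entering edge type is part of a state because a
  node becomes a collider or a non-collider only when the walk leaves it; a node may thus be
  processed once per edge type, hence the factor 4 in the time bound for TestSep.

  When a walk is transferred to another candidate, a non-collider entered by an arrowhead is known
  to be an anterior only from the rest of the walk, so the induction must remember that
  \<open>Y\<close> can still be reached.

  TestSep and FindSep are relations: correctness is shown for every result they can produce, and the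
  existence of a result comes from the run of the machine program.\<close>

lemma ex_path_between_iff:
  assumes adj: "\<And>a b. R a b \<Longrightarrow> adjacent G a b" and verts: "\<And>a b. R a b \<Longrightarrow> b \<in> verts G"
  shows "(\<exists>p. path_between G u p w \<and> successively R p) \<longleftrightarrow> u \<in> verts G \<and> R\<^sup>*\<^sup>* u w"
proof
  assume "\<exists>p. path_between G u p w \<and> successively R p"
  then obtain p where p: "path_between G u p w" "successively R p" by blast
  have "R\<^sup>*\<^sup>* (hd q) (last q)" if "q \<noteq> []" "successively R q" for q
    using that
    by (induction q rule: induct_list012)
      (auto intro: converse_rtranclp_into_rtranclp split: if_splits)
  with p show "u \<in> verts G \<and> R\<^sup>*\<^sup>* u w"
    unfolding path_between_def path_def by (metis hd_in_set subsetD)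
next
  assume "u \<in> verts G \<and> R\<^sup>*\<^sup>* u w"
  then have "R\<^sup>*\<^sup>* u w" and u: "u \<in> verts G" by auto
  then have "\<exists>p. p \<noteq> [] \<and> set p \<subseteq> verts G \<and> distinct p \<and> hd p = u \<and> last p = w \<and> successively R p"
  proof (induction rule: rtranclp_induct)
    case base
    then show ?case by (intro exI[of _ "[u]"]) auto
  next
    case (step y z)
    then obtain p where p: "p \<noteq> []" "set p \<subseteq> verts G" "distinct p" "hd p = u" "last p = y"
      "successively R p" by blast
    show ?case
    \<comment> \<open>Distinctness is kept by cutting: if \<open>z\<close> already lies on the path,
      the prefix that ends there replaces the extension.\<close>
    proof (cases "z \<in> set p")
      case True
      then obtain a b where "p = a @ z # b" by (meson split_list)
      with p show ?thesis
        by (intro exI[of _ "a @ [z]"])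
          (auto simp: successively_append_iff hd_append split: if_splits)
    next
      case False
      with p verts[OF step(2)] step(2) show ?thesis
        by (intro exI[of _ "p @ [z]"]) (auto simp: successively_append_iff)
    qed
  qed
  then obtain p where p: "p \<noteq> []" "set p \<subseteq> verts G" "distinct p" "hd p = u" "last p = w"
    "successively R p" by blast
  moreover have "successively (adjacent G) p"
    using p(6) adj by (rule successively_mono)
  ultimately show "\<exists>p. path_between G u p w \<and> successively R p"
    unfolding path_between_def path_def by blast
qed

text \<open>With \<open>C = Z\<close> the two branches are the two disjuncts of
  \<open>m_connecting\<close>. A node is constrained only when it is left, so the last node of a
  walk satisfies no condition yet.\<close>

definition walk_step ::
    "'v mixed_graph \<Rightarrow> 'v set \<Rightarrow> 'v set \<Rightarrow> ((edge_type \<times> 'v) \<times> (edge_type \<times> 'v)) set" where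
  "walk_step G C Z = {((e, T), (f, N)). edge G T f N \<and>
     (if head_at_end e \<and> head_at_start f then T \<in> C else T \<notin> Z)}"

definition reach ::
    "'v mixed_graph \<Rightarrow> 'v set \<Rightarrow> 'v set \<Rightarrow> 'v set \<Rightarrow> (edge_type \<times> 'v) set" where
  "reach G C Z X = (walk_step G C Z)\<^sup>* `` ({From} \<times> X)"

lemma reach_start: "x \<in> X \<Longrightarrow> (From, x) \<in> reach G C Z X"
  by (auto simp: reach_def)

lemma reach_step:
  "(e, T) \<in> reach G C Z X \<Longrightarrow> edge G T f N \<Longrightarrow>
    (if head_at_end e \<and> head_at_start f then T \<in> C else T \<notin> Z) \<Longrightarrow> (f, N) \<in> reach G C Z X"
  unfolding reach_def
  by (auto simp: walk_step_def intro: rtrancl_into_rtrancl)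

lemma reach_induct [consumes 1, case_names start step]:
  assumes "(e, T) \<in> reach G C Z X"
    and "\<And>x. x \<in> X \<Longrightarrow> P From x"
    and "\<And>e T f N. (e, T) \<in> reach G C Z X \<Longrightarrow> P e T \<Longrightarrow> edge G T f N \<Longrightarrow>
      (if head_at_end e \<and> head_at_start f then T \<in> C else T \<notin> Z) \<Longrightarrow> P f N"
  shows "P e T"
proof -
  from assms(1) obtain x where x: "x \<in> X" and "((From, x), (e, T)) \<in> (walk_step G C Z)\<^sup>*"
    by (auto simp: reach_def)
  from this(2) show ?thesis
  proof (induction rule: rtrancl_induct2)
    case refl
    then show ?case using assms(2) x .
  next
    case (step e T f N)
    then have "(e, T) \<in> reach G C Z X" using x by (auto simp: reach_def)
    with step show ?case using assms(3) by (auto simp: walk_step_def)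
  qed
qed

lemma reach_mono:
  assumes "C \<subseteq> D" and "(e, T) \<in> reach G C Z X"
  shows "(e, T) \<in> reach G D Z X"
  using assms(2)
proof (induction rule: reach_induct)
  case (start x)
  then show ?case by (rule reach_start)
next
  case (step e T f N)
  from step(4,2) show ?case by (rule reach_step) (use step(3) assms(1) in \<open>auto split: if_splits\<close>)
qed

text \<open>Every pair that has been removed from \<open>P\<close> lies outside \<open>Y\<close> and
  has all its successors in \<open>Q\<close>. Pairs added to \<open>Q\<close> are successors of a
  pair in \<open>Q\<close>, so the closure of \<open>Q\<close> never changes; once \<open>P\<close>
  is empty, \<open>Q\<close> is itself closed. The order of removal does not enter the argument,
  which therefore covers every execution.\<close>

lemma test_sep_loop_result:
  assumes "test_sep_loop G Y Z P Q b" and "P \<subseteq> Q"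
    and "\<And>e T. (e, T) \<in> Q - P \<Longrightarrow> T \<notin> Y \<and> walk_step G Z Z `` {(e, T)} \<subseteq> Q"
  shows "b \<longleftrightarrow> snd ` ((walk_step G Z Z)\<^sup>* `` Q) \<inter> Y = {}"
  using assms
proof (induction rule: test_sep_loop.induct)
  case (finished Q)
  then have "walk_step G Z Z `` Q \<subseteq> Q" by auto
  then have "(walk_step G Z Z)\<^sup>* `` Q = Q" by (rule Image_closed_trancl)
  with finished show ?case by auto
next
  case (found e T P Q)
  then have "(e, T) \<in> (walk_step G Z Z)\<^sup>* `` Q" by blast
  with found(2) have "T \<in> snd ` ((walk_step G Z Z)\<^sup>* `` Q) \<inter> Y" by force
  then show ?case by blast
next
  case (continue e T P Q b)
  let ?W = "walk_step G Z Z" and ?N = "new_pairs G Z Q e T"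
  have N: "?N = ?W `` {(e, T)} - Q"
    by (auto simp: new_pairs_def walk_step_def m_connecting_def split: if_splits)
  have eT: "(e, T) \<in> Q" using continue by auto
  have "?W\<^sup>* `` (Q \<union> ?N) = ?W\<^sup>* `` Q"
  proof -
    have "?N \<subseteq> ?W\<^sup>* `` Q" unfolding N using eT by blast
    then have "?W\<^sup>* `` ?N \<subseteq> ?W\<^sup>* `` (?W\<^sup>* `` Q)" by (rule Image_mono[OF subset_refl])
    also have "\<dots> = ?W\<^sup>* `` Q" by (simp flip: relcomp_Image)
    finally have "?W\<^sup>* `` ?N \<subseteq> ?W\<^sup>* `` Q" .
    then show ?thesis by auto
  qed
  moreover have "b \<longleftrightarrow> snd ` (?W\<^sup>* `` (Q \<union> ?N)) \<inter> Y = {}"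
  proof (rule continue.IH)
    show "P - {(e, T)} \<union> ?N \<subseteq> Q \<union> ?N" using continue.prems by auto
    fix e' T' assume *: "(e', T') \<in> Q \<union> ?N - (P - {(e, T)} \<union> ?N)"
    show "T' \<notin> Y \<and> ?W `` {(e', T')} \<subseteq> Q \<union> ?N"
    proof (cases "(e', T') = (e, T)")
      case True
      then show ?thesis using continue.hyps N by auto
    next
      case False
      then show ?thesis using continue.prems(2)[of e' T'] * by auto
    qed
  qed
  ultimately show ?case by simp
qed

lemma test_sep_result: "test_sep G X Y Z b \<Longrightarrow> b \<longleftrightarrow> snd ` reach G Z Z X \<inter> Y = {}"
  unfolding test_sep_def reach_def by (rule test_sep_loop_result) auto

fun reverse_type :: "edge_type \<Rightarrow> edge_type" where
  "reverse_type To = From"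
| "reverse_type From = To"
| "reverse_type Undir = Undir"
| "reverse_type Bidir = Bidir"

lemma edge_reverse: "edge G u t v \<Longrightarrow> edge G v (reverse_type t) u"
  by (cases t) (auto simp: insert_commute)

declare edge.simps [simp del]

abbreviation directed_step :: "'v mixed_graph \<Rightarrow> 'v \<Rightarrow> 'v \<Rightarrow> bool" where
  "directed_step G a b \<equiv> edge G a To b"

abbreviation anterior_step :: "'v mixed_graph \<Rightarrow> 'v \<Rightarrow> 'v \<Rightarrow> bool" where
  "anterior_step G a b \<equiv> edge G a To b \<or> edge G a Undir b"

text \<open>These are the walks of \<open>reach\<close> that visit no node twice. The type of the
  last edge is an index because, together with the next edge, it decides whether the last node
  becomes a collider; a single node carries the artificial \<open>From\<close>.\<close>

inductive open_path ::
    "'v mixed_graph \<Rightarrow> 'v set \<Rightarrow> 'v set \<Rightarrow> 'v set \<Rightarrow> 'v list \<Rightarrow> edge_type \<Rightarrow> bool"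
  for G C Z X where
  start: "x \<in> X \<Longrightarrow> open_path G C Z X [x] From"
| step: "open_path G C Z X p e \<Longrightarrow> edge G (last p) f N \<Longrightarrow> N \<notin> set p \<Longrightarrow>
    (if head_at_end e \<and> head_at_start f then last p \<in> C else last p \<notin> Z) \<Longrightarrow>
    open_path G C Z X (p @ [N]) f"

lemma open_path_nonempty: "open_path G C Z X p e \<Longrightarrow> p \<noteq> []"
  by (induction rule: open_path.induct) auto

section \<open>m-separation in ancestral graphs\<close>

locale ancestral =
  fixes G :: "'v mixed_graph"
  assumes ancestral: "ancestral_graph G"
begin

lemma edge_verts: "edge G u t v \<Longrightarrow> u \<in> verts G \<and> v \<in> verts G \<and> u \<noteq> v"
proof -
  have G: "mixed_graph G" using ancestral by (simp add: ancestral_graph_def)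
  assume e: "edge G u t v"
  then consider "(u, v) \<in> directed G" | "(v, u) \<in> directed G"
    | "{u, v} \<in> undirected G \<union> bidirected G"
    by (cases t) (auto simp: edge.simps)
  then show ?thesis
  proof cases
    case 3
    then have "{u, v} \<subseteq> verts G" "card {u, v} = 2" using G unfolding mixed_graph_def by blast+
    then show ?thesis by (cases "u = v") auto
  qed (use G in \<open>auto simp: mixed_graph_def\<close>)
qed

lemma ancestor_iff: "ancestor G u w \<longleftrightarrow> u \<in> verts G \<and> (directed_step G)\<^sup>*\<^sup>* u w"
  unfolding ancestor_def
  by (rule ex_path_between_iff) (use edge_verts in \<open>auto simp: adjacent_def\<close>)

lemma anterior_iff: "anterior G u w \<longleftrightarrow> u \<in> verts G \<and> (anterior_step G)\<^sup>*\<^sup>* u w"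
  unfolding anterior_def
  by (rule ex_path_between_iff) (use edge_verts in \<open>auto simp: adjacent_def\<close>)

lemma not_anterior_head: "edge G a t b \<Longrightarrow> head_at_start t \<Longrightarrow> \<not> anterior G a b"
  using ancestral unfolding ancestral_graph_def head_at_start_def by blast

lemma undirected_no_head: "edge G a Undir b \<Longrightarrow> edge G c t a \<Longrightarrow> \<not> head_at_end t"
  using ancestral edge_reverse[of G c t a]
  unfolding ancestral_graph_def head_at_end_def by (metis reverse_type.simps(1,4))

text \<open>\<open>To\<close> or \<open>Undir\<close> makes \<open>u\<close> an anterior of
  \<open>v\<close>, which excludes a second edge with a head at \<open>u\<close>. \<open>To\<close>
  beside \<open>Undir\<close> would put a head on an end of an undirected edge, and
  \<open>From\<close> beside \<open>Bidir\<close> is the first case seen from \<open>v\<close>.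
  Hence \<open>collider\<close>, which looks only at nodes, agrees with the types carried by
  walks.\<close>

lemma edge_unique:
  assumes "edge G u t v" "edge G u t' v"
  shows "t = t'"
proof -
  have 1: "\<not> head_at_start s" if "edge G u To v \<or> edge G u Undir v" "edge G u s v" for u v s
    using not_anterior_head[OF that(2)] anterior_iff that edge_verts[OF that(2)] by blast
  have 2: False if "edge G u To v" "edge G u Undir v" for u v
    using undirected_no_head[of v u u To] that by (auto simp: edge.simps insert_commute head_at_end_def)
  have 3: False if "edge G u From v" "edge G u Bidir v" for u v
    using 1[of v u Bidir] that by (auto simp: edge.simps insert_commute head_at_start_def)
  show ?thesis
    using 1[of u v t] 1[of u v t'] 2[of u v] 3[of u v] assms
    by (cases t; cases t') (auto simp: head_at_start_def)
qed

lemma arrowhead_at_iff: "edge G u t v \<Longrightarrow> arrowhead_at G u v \<longleftrightarrow> head_at_end t"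
  unfolding arrowhead_at_def head_at_end_def using edge_unique by blast

lemma arrowhead_at_reverse_iff: "edge G u t v \<Longrightarrow> arrowhead_at G v u \<longleftrightarrow> head_at_start t"
  using arrowhead_at_iff[OF edge_reverse, of u t v]
  by (cases t) (auto simp: head_at_end_def head_at_start_def)

lemma subset_An: "S \<subseteq> verts G \<Longrightarrow> S \<subseteq> An G S"
  by (auto simp: An_def ancestor_iff)

lemma subset_Ant: "S \<subseteq> verts G \<Longrightarrow> S \<subseteq> Ant G S"
  by (auto simp: Ant_def anterior_iff)

lemma An_directed: "directed_step G a b \<Longrightarrow> b \<in> An G S \<Longrightarrow> a \<in> An G S"
  unfolding An_def mem_Collect_eq ancestor_iff
  using edge_verts by (metis (no_types, lifting) converse_rtranclp_into_rtranclp)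

lemma An_rtranclp: "(directed_step G)\<^sup>*\<^sup>* a b \<Longrightarrow> b \<in> An G S \<Longrightarrow> a \<in> An G S"
  by (induction rule: converse_rtranclp_induct) (auto intro: An_directed)

lemma Ant_step: "anterior_step G a b \<Longrightarrow> b \<in> Ant G S \<Longrightarrow> a \<in> Ant G S"
  unfolding Ant_def mem_Collect_eq anterior_iff
  using edge_verts by (metis (mono_tags, lifting) converse_rtranclp_into_rtranclp)

lemma An_Ant_subset: "An G (Ant G S) \<subseteq> Ant G S"
proof
  fix u assume "u \<in> An G (Ant G S)"
  then obtain w where w: "w \<in> Ant G S" "(directed_step G)\<^sup>*\<^sup>* u w" by (auto simp: An_def ancestor_iff)
  from w(2,1) show "u \<in> Ant G S"
    by (induction rule: converse_rtranclp_induct) (auto intro: Ant_step)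
qed

text \<open>An arrowhead at \<open>T\<close> excludes undirected edges at \<open>T\<close>, so the
  next step of the anterior path is directed and puts an arrowhead on the following node. The
  argument repeats up to the end of the path.\<close>

lemma Ant_imp_An:
  assumes "edge G S e T" "head_at_end e" "T \<in> Ant G W"
  shows "T \<in> An G W"
proof -
  obtain w where w: "w \<in> W" "(anterior_step G)\<^sup>*\<^sup>* T w" "T \<in> verts G"
    using assms(3) by (auto simp: Ant_def anterior_iff)
  have "(directed_step G)\<^sup>*\<^sup>* T w"
    using w(2) assms(1,2)
  proof (induction arbitrary: S e rule: converse_rtranclp_induct)
    case base
    then show ?case by simp
  next
    case (step T T')
    then have "edge G T To T'" using undirected_no_head by blast
    with step(3)[OF this] show ?case by (simp add: head_at_end_def converse_rtranclp_into_rtranclp)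
  qed
  with w show ?thesis by (auto simp: An_def ancestor_iff)
qed

section \<open>m-connecting paths and open walks\<close>

lemma m_connected_imp_reach:
  assumes "m_connected G Z u w" and "u \<in> X"
  shows "\<exists>e. (e, w) \<in> reach G (An G Z) Z X"
proof -
  obtain p where p: "path G p" "hd p = u" "last p = w"
    and ok: "\<And>i. i < length p \<Longrightarrow> if collider G p i then p ! i \<in> An G Z else p ! i \<notin> Z"
    using assms(1) unfolding m_connected_def path_between_def by blast
  have ne: "p \<noteq> []" using p(1) unfolding path_def by blast
  have edges: "\<exists>f. edge G (p ! i) f (p ! Suc i)" if "Suc i < length p" for i
    using p(1) that unfolding path_def adjacent_def successively_conv_nth by blast
  have "i < length p \<Longrightarrow> \<exists>e. (e, p ! i) \<in> reach G (An G Z) Z X \<and>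
      (if i = 0 then e = From else edge G (p ! (i - 1)) e (p ! i))" for i
  proof (induction i)
    case 0
    have "p ! 0 \<in> X" using p(2) ne assms(2) by (simp add: hd_conv_nth)
    then show ?case by (intro exI[of _ From]) (simp add: reach_start)
  next
    case (Suc i)
    then obtain e where e: "(e, p ! i) \<in> reach G (An G Z) Z X"
      "if i = 0 then e = From else edge G (p ! (i - 1)) e (p ! i)" by auto
    obtain f where f: "edge G (p ! i) f (p ! Suc i)" using edges Suc(2) by blast
    have "i > 0 \<Longrightarrow> arrowhead_at G (p ! (i - 1)) (p ! i) \<longleftrightarrow> head_at_end e"
      using e(2) arrowhead_at_iff by simp
    \<comment> \<open>At \<open>i = 0\<close> the artificial \<open>From\<close> has no head, in
      agreement with end nodes never being colliders.\<close>
    then have "collider G p i \<longleftrightarrow> head_at_end e \<and> head_at_start f"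
      using e(2) arrowhead_at_reverse_iff[OF f] Suc(2)
      unfolding collider_def by (cases "i = 0") (simp_all add: head_at_end_def)
    then have "(f, p ! Suc i) \<in> reach G (An G Z) Z X"
      using reach_step[OF e(1) f] ok[of i] Suc(2) by simp
    with f show ?case by auto
  qed
  from this[of "length p - 1"] show ?thesis
    using ne p(3) by (auto simp: last_conv_nth)
qed

text \<open>Here \<open>q\<close> is the prefix of \<open>p\<close> that ends in \<open>v\<close>.
  If \<open>v \<in> Z\<close>, then \<open>v\<close> is a collider of \<open>p\<close>, so
  \<open>q\<close> enters it by a head. Suppose that \<open>q\<close> enters \<open>v\<close> by a
  head. If \<open>p\<close> leaves \<open>v\<close> with a head at \<open>v\<close>, then
  \<open>v\<close> is a collider in \<open>An G Z\<close>. Otherwise \<open>p\<close> leaves by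
  \<open>To\<close>, since an undirected edge cannot meet the head, and every further edge is
  \<open>To\<close> as well until one creates a collider in \<open>An G Z\<close> below
  \<open>v\<close>.\<close>

lemma open_path_cut:
  assumes "open_path G (An G Z) Z X p e" and "X \<inter> Z = {}" and "v \<in> set p" and "v \<noteq> last p"
  shows "\<exists>q e'. open_path G (An G Z) Z X q e' \<and> last q = v \<and> (v \<in> Z \<longrightarrow> head_at_end e') \<and>
    (head_at_end e' \<longrightarrow> v \<in> An G Z \<or> (directed_step G)\<^sup>*\<^sup>* v (last p) \<and> e = To)"
  using assms
proof (induction rule: open_path.induct)
  case (start x)
  then show ?case by auto
next
  case (step p e f N)
  show ?case
  proof (cases "v = last p")
    case True
    have p: "e = From \<and> p = [last p] \<and> last p \<in> X \<or> (\<exists>S. edge G S e (last p))"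
      using step.hyps(1) by cases auto
    have "head_at_end e \<Longrightarrow> v \<in> An G Z \<or> f = To"
      using p True step.hyps undirected_no_head
      by (cases f) (auto simp: head_at_end_def head_at_start_def split: if_splits)
    then show ?thesis
      using step True p by (intro exI[of _ p] exI[of _ e]) (auto split: if_splits)
  next
    case False
    then obtain q e' where q: "open_path G (An G Z) Z X q e'" "last q = v" "v \<in> Z \<longrightarrow> head_at_end e'"
      "head_at_end e' \<longrightarrow> v \<in> An G Z \<or> (directed_step G)\<^sup>*\<^sup>* v (last p) \<and> e = To"
      using step by auto
    have "v \<in> An G Z \<or> (directed_step G)\<^sup>*\<^sup>* v N \<and> f = To"
      if d: "(directed_step G)\<^sup>*\<^sup>* v (last p)" and "e = To"
    proof (cases "head_at_start f")
      case True
      then have "last p \<in> An G Z" using step.hyps \<open>e = To\<close> by (auto simp: head_at_end_def)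
      with An_rtranclp[OF d] show ?thesis by blast
    next
      case False
      have "\<exists>S. edge G S e (last p)" using step.hyps(1) \<open>e = To\<close> by cases auto
      then have "f = To"
        using False step.hyps \<open>e = To\<close> undirected_no_head
        by (cases f) (auto simp: head_at_end_def head_at_start_def)
      with d step.hyps(2) show ?thesis by (auto intro: rtranclp.rtrancl_into_rtrancl)
    qed
    with q show ?thesis by auto
  qed
qed

text \<open>A walk is shortened to a path by cutting out loops.  The last edge of the path may then
  differ from that of the walk, but only in the two ways that keep every continuation open.\<close>

lemma reach_imp_open_path:
  assumes "(e, T) \<in> reach G (An G Z) Z X" and "X \<inter> Z = {}"
  shows "\<exists>p e'. open_path G (An G Z) Z X p e' \<and> last p = T \<and>
    (T \<in> Z \<longrightarrow> head_at_end e \<longrightarrow> head_at_end e') \<and>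
    (head_at_end e' \<longrightarrow> head_at_end e \<or> T \<in> An G Z)"
  using assms
proof (induction rule: reach_induct)
  case (start x)
  then show ?case by (intro exI[of _ "[x]"] exI[of _ From]) (auto intro: open_path.start)
next
  case (step e T f N)
  then obtain p e' where p: "open_path G (An G Z) Z X p e'" "last p = T"
    "T \<in> Z \<longrightarrow> head_at_end e \<longrightarrow> head_at_end e'"
    "head_at_end e' \<longrightarrow> head_at_end e \<or> T \<in> An G Z" by blast
  \<comment> \<open>The invariant permits replacing \<open>e\<close> by \<open>e'\<close> in both
    directions: if only \<open>e'\<close> has a head, then \<open>T \<in> An G Z\<close>, as a
    collider requires; if only \<open>e\<close> has one, then \<open>T \<notin> Z\<close>, as a
    non-collider requires.\<close>
  have ok: "if head_at_end e' \<and> head_at_start f then T \<in> An G Z else T \<notin> Z"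
    using step(3) p(3,4) by argo
  show ?case
  proof (cases "N \<in> set p")
    case False
    with p(1,2) ok step(2) have "open_path G (An G Z) Z X (p @ [N]) f"
      by (metis open_path.step)
    then show ?thesis by (intro exI[of _ "p @ [N]"] exI[of _ f]) auto
  next
    case True
    have "N \<noteq> last p" using edge_verts[OF step(2)] p(2) by auto
    from open_path_cut[OF p(1) step(5) True this] obtain q e'' where
      q: "open_path G (An G Z) Z X q e''" "last q = N" "N \<in> Z \<longrightarrow> head_at_end e''"
      "head_at_end e'' \<longrightarrow> N \<in> An G Z \<or> (directed_step G)\<^sup>*\<^sup>* N T \<and> e' = To"
      using p(2) by blast
    \<comment> \<open>The shortened path may enter \<open>N\<close> by a head that \<open>f\<close>
      lacks. In the case treated here the removed loop is directed from \<open>N\<close> to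
      \<open>T\<close>. A head of \<open>f\<close> at \<open>T\<close> forces \<open>T\<close>, and
      with it \<open>N\<close>, into \<open>An G Z\<close>; otherwise \<open>f\<close> is
      \<open>To\<close> and has the required head at \<open>N\<close>.\<close>
    have "head_at_end f \<or> N \<in> An G Z" if d: "(directed_step G)\<^sup>*\<^sup>* N T" and "e' = To"
    proof (cases "head_at_start f")
      case True
      then have "T \<in> An G Z" using ok \<open>e' = To\<close> by (auto simp: head_at_end_def)
      with An_rtranclp[OF d] show ?thesis by blast
    next
      case False
      have "\<exists>S. edge G S e' (last p)" using p(1) \<open>e' = To\<close> by cases auto
      then have "f \<noteq> Undir"
        using step(2) p(2) \<open>e' = To\<close> undirected_no_head by (auto simp: head_at_end_def)
      with False show ?thesis by (cases f) (auto simp: head_at_end_def head_at_start_def)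
    qed
    with q show ?thesis by blast
  qed
qed

text \<open>The last node is exempt because \<open>open_path\<close> constrains a node only when an
  edge leaves it. For an m-connecting path the missing condition is that the end node is not in
  \<open>Z\<close>.\<close>

lemma open_path_imp_path:
  assumes "open_path G (An G Z) Z X p e" and "X \<subseteq> verts G"
  shows "path G p \<and> hd p \<in> X \<and>
    (if length p = 1 then e = From else edge G (p ! (length p - 2)) e (last p)) \<and>
    (\<forall>i < length p - 1. if collider G p i then p ! i \<in> An G Z else p ! i \<notin> Z)"
  using assms
proof (induction rule: open_path.induct)
  case (start x)
  then show ?case by (auto simp: path_def)
next
  case (step p e f N)
  have ne: "p \<noteq> []" using step.hyps(1) by (rule open_path_nonempty)
  have pN: "path G (p @ [N])"
    using step ne edge_verts[OF step.hyps(2)]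
    by (auto simp: path_def successively_append_iff adjacent_def)
  have e: "edge G ((p @ [N]) ! (length (p @ [N]) - 2)) f (last (p @ [N]))"
    using step.hyps(2) ne by (auto simp: nth_append last_conv_nth)
  have "if collider G (p @ [N]) i then (p @ [N]) ! i \<in> An G Z else (p @ [N]) ! i \<notin> Z"
    if "i < length p" for i
  proof (cases "i < length p - 1")
    case True
    then have "collider G (p @ [N]) i \<longleftrightarrow> collider G p i"
      by (auto simp: collider_def nth_append)
    then show ?thesis using step True by (auto simp: nth_append)
  next
    case False
    then have i: "i = length p - 1" using that by auto
    have l: "(p @ [N]) ! i = last p" "(p @ [N]) ! Suc i = N"
      using ne i by (auto simp: nth_append last_conv_nth)
    have "collider G (p @ [N]) i \<longleftrightarrow> head_at_end e \<and> head_at_start f"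
    proof (cases "length p = 1")
      case True
      then show ?thesis using step i by (auto simp: collider_def head_at_end_def)
    next
      case False
      then have "length p > 1" using ne by (cases p) auto
      then have "edge G ((p @ [N]) ! (i - 1)) e (last p)"
        using step False i by (auto simp: nth_append numeral_2_eq_2)
      with l arrowhead_at_iff[OF this] arrowhead_at_reverse_iff[OF step.hyps(2)] \<open>length p > 1\<close> i
      show ?thesis by (auto simp: collider_def)
    qed
    with l step.hyps(4) show ?thesis by simp
  qed
  with pN e step ne show ?case by auto
qed

lemma reach_imp_m_connected:
  assumes "(e, w) \<in> reach G (An G Z) Z X" and "X \<inter> Z = {}" and "w \<notin> Z" and "X \<subseteq> verts G"
  shows "\<exists>u \<in> X. m_connected G Z u w"
proof -
  obtain p e' where p: "open_path G (An G Z) Z X p e'" "last p = w"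
    using reach_imp_open_path[OF assms(1,2)] by blast
  note path = open_path_imp_path[OF p(1) assms(4)]
  have ne: "p \<noteq> []" using p(1) by (rule open_path_nonempty)
  have "if collider G p i then p ! i \<in> An G Z else p ! i \<notin> Z" if "i < length p" for i
  proof (cases "i = length p - 1")
    case True
    then show ?thesis using assms(3) p(2) ne by (auto simp: collider_def last_conv_nth)
  next
    case False
    with path that show ?thesis by auto
  qed
  with path p(2) show ?thesis unfolding m_connected_def path_between_def by blast
qed

text \<open>A walk through a collider in \<open>An Z\<close> may instead descend to \<open>Z\<close> and come back.\<close>

lemma reach_descend:
  assumes "(directed_step G)\<^sup>*\<^sup>* T z" and "z \<in> Z" and "T \<notin> Z" and "(e, T) \<in> reach G Z Z X"
  shows "(From, T) \<in> reach G Z Z X"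
  using assms
proof (induction arbitrary: e rule: converse_rtranclp_induct)
  case base
  then show ?case by simp
next
  case (step T T')
  have up: "edge G T' From T" using edge_reverse[OF step(1)] by simp
  have down: "(To, T') \<in> reach G Z Z X"
    by (rule reach_step[OF step(6) step(1)]) (use step in \<open>auto simp: head_at_start_def\<close>)
  show ?case
  \<comment> \<open>The walk turns at the first node of \<open>Z\<close> that it meets, where
    \<open>To\<close> followed by \<open>From\<close> is a collider. The nodes above it are passed
    as non-colliders in both directions.\<close>
  proof (cases "T' \<in> Z")
    case True
    then show ?thesis
      by (intro reach_step[OF down up]) (auto simp: head_at_start_def head_at_end_def)
  next
    case False
    then have "(From, T') \<in> reach G Z Z X" using step down by blast
    then show ?thesis
      by (rule reach_step[OF _ up]) (use False in \<open>auto simp: head_at_end_def\<close>)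
  qed
qed

lemma reach_An_iff:
  assumes "Z \<subseteq> verts G"
  shows "reach G (An G Z) Z X = reach G Z Z X"
proof -
  have "(e, T) \<in> reach G Z Z X" if "(e, T) \<in> reach G (An G Z) Z X" for e T
    using that
  proof (induction rule: reach_induct)
    case (start x)
    then show ?case by (rule reach_start)
  next
    case (step e T f N)
    show ?case
    proof (cases "head_at_end e \<and> head_at_start f \<and> T \<notin> Z")
      case True
      then have "T \<in> An G Z" using step(3) by simp
      then obtain z where "z \<in> Z" "(directed_step G)\<^sup>*\<^sup>* T z" by (auto simp: An_def ancestor_iff)
      \<comment> \<open>After the detour \<open>T\<close> is entered by a tail, hence is a
        non-collider, and \<open>T \<notin> Z\<close> permits any continuation.\<close>
      then have "(From, T) \<in> reach G Z Z X" using reach_descend True step(4) by blast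
      then show ?thesis
        by (rule reach_step[OF _ step(2)]) (use True in \<open>auto simp: head_at_end_def\<close>)
    next
      case False
      with reach_step[OF step(4,2)] step(3) show ?thesis by (auto split: if_splits)
    qed
  qed
  moreover have "(e, T) \<in> reach G (An G Z) Z X" if "(e, T) \<in> reach G Z Z X" for e T
    using reach_mono[OF subset_An[OF assms] that] .
  ultimately show ?thesis by auto
qed

lemma m_separates_iff_reach:
  assumes "X \<subseteq> verts G" "Z \<subseteq> verts G" "X \<inter> Z = {}" "Y \<inter> Z = {}"
  shows "m_separates G Z X Y \<longleftrightarrow> snd ` reach G (An G Z) Z X \<inter> Y = {}"
proof -
  have "snd ` reach G (An G Z) Z X \<inter> Y \<noteq> {}" if "u \<in> X" "w \<in> Y" "m_connected G Z u w" for u w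
    using m_connected_imp_reach[OF that(3,1)] that(2) by force
  moreover have "\<not> m_separates G Z X Y" if "(e, w) \<in> reach G (An G Z) Z X" "w \<in> Y" for e w
    using reach_imp_m_connected[OF that(1)] that(2) assms unfolding m_separates_def by blast
  ultimately show ?thesis unfolding m_separates_def by fastforce
qed

lemma test_sep_iff_m_separates:
  assumes "X \<subseteq> verts G" "Z \<subseteq> verts G" "X \<inter> Z = {}" "Y \<inter> Z = {}"
    and "test_sep G X Y Z b"
  shows "b \<longleftrightarrow> m_separates G Z X Y"
  using test_sep_result[OF assms(5)] m_separates_iff_reach[OF assms(1-4)]
    reach_An_iff[OF assms(2), of X] by simp

section \<open>Rerouting along directed paths, and anteriors on open walks\<close>

lemma reach_directed:
  assumes "(directed_step G)\<^sup>*\<^sup>* T y" and "T \<notin> An G Z" and "Z \<subseteq> verts G"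
    and "(e, T) \<in> reach G C Z X"
  shows "\<exists>e. (e, y) \<in> reach G C Z X"
  using assms
proof (induction arbitrary: e rule: converse_rtranclp_induct)
  case base
  then show ?case by blast
next
  case (step T T')
  \<comment> \<open>\<open>T\<close> is left by a tail and thus is no collider, so the step is open
    for every \<open>C\<close>. From \<open>T \<notin> An G Z\<close> follow
    \<open>T \<notin> Z\<close> and the same hypothesis for \<open>T'\<close>.\<close>
  have "(To, T') \<in> reach G C Z X"
    by (rule reach_step[OF step(6) step(1)])
      (use step subset_An[OF step(5)] in \<open>auto simp: head_at_start_def\<close>)
  then show ?case using step An_directed by blast
qed

lemma reach_directed_reverse:
  assumes "(directed_step G)\<^sup>*\<^sup>* T x" and "T \<notin> An G Z" and "Z \<subseteq> verts G" and "x \<in> X"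
  shows "(From, T) \<in> reach G C Z X"
  using assms
proof (induction rule: converse_rtranclp_induct)
  case base
  then show ?case by (simp add: reach_start)
next
  case (step T T')
  have "T' \<notin> An G Z" using step An_directed by blast
  with step have "(From, T') \<in> reach G C Z X" by blast
  then show ?case
    by (rule reach_step)
      (use edge_reverse[OF step(1)] \<open>T' \<notin> An G Z\<close> subset_An[OF step(5)] in \<open>auto simp: head_at_end_def\<close>)
qed

text \<open>An edge with a tail at its end \<open>N\<close> makes \<open>N\<close> an anterior of
  its predecessor \<open>T\<close>. Either \<open>T\<close> was entered by a tail, and the induction
  applies, or by a head; then the edge to \<open>N\<close> cannot be undirected, so \<open>T\<close>
  is a collider and lies in \<open>An G Z\<close>. The first conjunct provides the edge that shows
  the head at \<open>T\<close>.\<close>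

lemma reach_tail_Ant:
  assumes "(e, T) \<in> reach G (An G Z) Z X" and "X \<subseteq> Ant G W" and "An G Z \<subseteq> Ant G W"
  shows "(head_at_end e \<longrightarrow> (\<exists>S. edge G S e T)) \<and> (\<not> head_at_end e \<longrightarrow> T \<in> Ant G W)"
  using assms
proof (induction rule: reach_induct)
  case (start x)
  then show ?case by (auto simp: head_at_end_def)
next
  case (step e T f N)
  have "N \<in> Ant G W" if "\<not> head_at_end f"
  proof -
    have "anterior_step G N T" "f = From \<or> f = Undir"
      using that edge_reverse[OF step(2)] by (cases f; auto simp: head_at_end_def)+
    moreover have "T \<in> Ant G W"
      using step that undirected_no_head \<open>f = From \<or> f = Undir\<close>
      by (auto simp: head_at_start_def split: if_splits)
    ultimately show ?thesis by (metis Ant_step)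
  qed
  with step show ?case by auto
qed

text \<open>The counterpart of \<open>reach_tail_Ant\<close> along the rest of the walk. If the walk
  leaves \<open>N\<close> by a tail, then \<open>N\<close> is an anterior of the next node; if by a
  head, then the edge from \<open>T\<close> is not undirected and \<open>N\<close> is a collider in
  \<open>An G Z\<close>. The chain ends at the latest in \<open>y\<close>.\<close>

lemma coreach_tail_Ant:
  assumes "((f, N), (g, y)) \<in> (walk_step G (An G Z) Z)\<^sup>*" and "y \<in> Ant G W" and "An G Z \<subseteq> Ant G W"
    and "edge G T f N" and "f = To \<or> f = Undir"
  shows "N \<in> Ant G W"
  using assms
proof (induction arbitrary: T rule: converse_rtrancl_induct2)
  case refl
  then show ?case by simp
next
  case (step f N g M)
  have e: "edge G N g M" and ok: "if head_at_end f \<and> head_at_start g then N \<in> An G Z else N \<notin> Z"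
    using step(1) by (auto simp: walk_step_def)
  show ?case
  proof (cases "head_at_start g")
    case True
    have "f \<noteq> Undir"
    proof
      assume "f = Undir"
      then have "edge G N Undir T" using step by (auto simp: edge.simps insert_commute)
      from undirected_no_head[OF this edge_reverse[OF e]] True show False
        by (cases g) (auto simp: head_at_end_def head_at_start_def)
    qed
    then show ?thesis using ok True step by (auto simp: head_at_end_def)
  next
    case False
    then have "g = To \<or> g = Undir" by (cases g) (auto simp: head_at_start_def)
    with step(3)[OF step(4,5) e] show ?thesis using e Ant_step by blast
  qed
qed

text \<open>The walk open for \<open>Ant (X \<union> Y \<union> I) \<inter> R\<close> is followed while keeping it open for \<open>Z\<close>.
  A collider outside \<open>An Z\<close> is an ancestor of \<open>X\<close>, and then the walk is restarted there, or of
  \<open>Y\<close>, and then the walk descends to \<open>Y\<close>.\<close>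

lemma reach_separator_transfer:
  assumes V: "X \<subseteq> verts G" "Y \<subseteq> verts G" "R \<subseteq> verts G"
    and Z: "I \<subseteq> Z" "Z \<subseteq> R" "R \<inter> (X \<union> Y) = {}"
    and W: "W = X \<union> Y \<union> I" and Z0: "Z0 = Ant G W \<inter> R"
    and y: "(g, y) \<in> reach G (An G Z0) Z0 X" "y \<in> Y"
  shows "snd ` reach G (An G Z) Z X \<inter> Y \<noteq> {}"
proof
  assume none: "snd ` reach G (An G Z) Z X \<inter> Y = {}"
  have WV: "W \<subseteq> verts G" and ZV: "Z \<subseteq> verts G" using V Z W by auto
  have A: "An G Z0 \<subseteq> Ant G W"
    using An_Ant_subset[of W] by (auto simp: Z0 An_def)
  have XA: "X \<subseteq> Ant G W" and YA: "Y \<subseteq> Ant G W" using subset_Ant[OF WV] W by auto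
  \<comment> \<open>The claim is restricted to states from which the walk still leads to
    \<open>Y\<close>: a non-collider entered by a head is placed in \<open>Ant G W\<close> by what
    follows it, not by what precedes it.\<close>
  have "\<forall>y \<in> Y. ((e, T), (g, y)) \<in> (walk_step G (An G Z0) Z0)\<^sup>* \<longrightarrow> (e, T) \<in> reach G (An G Z) Z X"
    if "(e, T) \<in> reach G (An G Z0) Z0 X" for e T
    using that
  proof (induction rule: reach_induct)
    case (start x)
    then show ?case by (simp add: reach_start)
  next
    case (step e T f N)
    show ?case
    proof (intro ballI impI)
      fix y assume y: "y \<in> Y" "((f, N), (g, y)) \<in> (walk_step G (An G Z0) Z0)\<^sup>*"
      then have "((e, T), (g, y)) \<in> (walk_step G (An G Z0) Z0)\<^sup>*"
        using step(2,3) by (auto simp: walk_step_def intro: converse_rtrancl_into_rtrancl)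
      with step(4) y have eT: "(e, T) \<in> reach G (An G Z) Z X" by blast
      note tail = reach_tail_Ant[OF step(1) XA A]
      show "(f, N) \<in> reach G (An G Z) Z X"
      proof (cases "head_at_end e \<and> head_at_start f")
        case False
        have "T \<in> Ant G W"
        proof (cases "head_at_end e")
          case True
          with False have f: "f = To \<or> f = Undir" by (cases f) (auto simp: head_at_start_def)
          have "N \<in> Ant G W"
            using coreach_tail_Ant[OF y(2) _ A step(2) f] y(1) YA by blast
          then show ?thesis using Ant_step f step(2) by blast
        next
          case False
          with tail show ?thesis by blast
        qed
        \<comment> \<open>As a non-collider \<open>T\<close> avoids \<open>Z0\<close>. Since it lies
          in \<open>Ant G W\<close>, it must be outside \<open>R\<close>, and so outside
          \<open>Z\<close>.\<close>
        then have "T \<notin> Z" using step(3) False Z Z0 by auto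
        with False show ?thesis by (intro reach_step[OF eT step(2)]) auto
      next
        case True
        show ?thesis
        proof (cases "T \<in> An G Z")
          case T: True
          with True show ?thesis by (intro reach_step[OF eT step(2)]) auto
        next
          case T: False
          \<comment> \<open>The collider \<open>T\<close> lies in \<open>An G Z0\<close> and hence
            in \<open>Ant G W\<close>; the arrowhead entering it makes its whole path to
            \<open>W\<close> directed.\<close>
          have "T \<in> An G W"
            using Ant_imp_An[of _ e T W] tail True step(3) A by auto
          then obtain w where w: "w \<in> W" "(directed_step G)\<^sup>*\<^sup>* T w" "T \<in> verts G"
            by (auto simp: An_def ancestor_iff)
          \<comment> \<open>Otherwise \<open>w \<in> I \<subseteq> Z\<close> would put
            \<open>T\<close> into \<open>An G Z\<close>.\<close>
          have "w \<notin> I" using T w Z by (auto simp: An_def ancestor_iff)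
          moreover have "w \<notin> Y"
            using reach_directed[OF w(2) T ZV eT] none by force
          ultimately have "w \<in> X" using w W by blast
          from reach_directed_reverse[OF w(2) T ZV this] show ?thesis
            by (rule reach_step[OF _ step(2)])
              (use T subset_An[OF ZV] in \<open>auto simp: head_at_end_def\<close>)
        qed
      qed
    qed
  qed
  with y none show False by force
qed

end

section \<open>Correctness of FindSep\<close>

lemma find_sep_correct:
  assumes inst: "find_sep_instance G X Y I R" and r: "find_sep G X Y I R r"
  shows "find_sep_solution G X Y I R r"
proof -
  interpret ancestral G using inst by unfold_locales (simp add: find_sep_instance_def)
  have V: "X \<subseteq> verts G" "Y \<subseteq> verts G" "R \<subseteq> verts G" and d: "R \<inter> (X \<union> Y) = {}" and I: "I \<subseteq> R"
    using inst unfolding find_sep_instance_def by blast+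
  define W where "W = X \<union> Y \<union> I"
  define Z0 where "Z0 = Ant G W \<inter> R"
  have "R - (X \<union> Y) = R" using d by blast
  with r obtain b where b: "test_sep G X Y Z0 b" "r = (if b then Some Z0 else None)"
    unfolding find_sep_def Let_def W_def Z0_def by metis
  have WV: "W \<subseteq> verts G" using V I unfolding W_def by blast
  have Z0: "I \<subseteq> Z0" "Z0 \<subseteq> R"
    using subset_Ant[OF WV] I unfolding Z0_def W_def by blast+
  have sub: "Z \<subseteq> verts G" "X \<inter> Z = {}" "Y \<inter> Z = {}" if "Z \<subseteq> R" for Z
    using that V d by blast+
  have sep: "b \<longleftrightarrow> m_separates G Z0 X Y"
    using test_sep_iff_m_separates[OF V(1) sub[OF Z0(2)] b(1)] .
  show ?thesis
  proof (cases b)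
    case True
    with b Z0 sep show ?thesis by (simp add: find_sep_solution_def)
  next
    case False
    then obtain g y where y: "(g, y) \<in> reach G (An G Z0) Z0 X" "y \<in> Y"
      using m_separates_iff_reach[OF V(1) sub[OF Z0(2)]] sep by fastforce
    have "\<not> m_separates G Z X Y" if Z: "I \<subseteq> Z" "Z \<subseteq> R" for Z
      using reach_separator_transfer[OF V Z d W_def Z0_def y]
        m_separates_iff_reach[OF V(1) sub[OF Z(2)]] by simp
    with b False show ?thesis by (auto simp: find_sep_solution_def)
  qed
qed

section \<open>Weakest preconditions with running time\<close>

text \<open>The existential quantifier makes termination part of the claim. The postcondition
  receives the running time, so a time bound is an ordinary conjunct of it.\<close>

definition wp ::
    "('r, 'a) com \<Rightarrow> (nat \<Rightarrow> ('r, 'a) state \<Rightarrow> bool) \<Rightarrow> ('r, 'a) state \<Rightarrow> bool" where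
  "wp c Q s \<longleftrightarrow> (\<exists>t s'. exec c s t s' \<and> Q t s')"

lemma wp_Skip: "Q 1 s \<Longrightarrow> wp Skip Q s"
  unfolding wp_def using exec.Skip by blast

lemma wp_Assign: "Q (1 + acost e) (s\<lparr>reg := (reg s)(x := aval e s)\<rparr>) \<Longrightarrow> wp (Assign x e) Q s"
  unfolding wp_def by (metis exec.Assign)

lemma wp_Store:
  "Q (1 + acost i + acost e) (s\<lparr>arr := (arr s)(a := (arr s a)(aval i s := aval e s))\<rparr>) \<Longrightarrow>
    wp (Store a i e) Q s"
  unfolding wp_def by (metis exec.Store)

lemma wp_Seq: "wp c1 (\<lambda>t1. wp c2 (\<lambda>t2. Q (t1 + t2))) s \<Longrightarrow> wp (c1 ;; c2) Q s"
  unfolding wp_def using exec.Seq by blast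

lemma wp_Cond:
  "(bval b s \<Longrightarrow> wp c1 (\<lambda>t. Q (1 + bcost b + t)) s) \<Longrightarrow>
    (\<not> bval b s \<Longrightarrow> wp c2 (\<lambda>t. Q (1 + bcost b + t)) s) \<Longrightarrow> wp (Cond b c1 c2) Q s"
  unfolding wp_def using exec.Cond_true exec.Cond_false by metis

lemma wp_mono: "wp c P s \<Longrightarrow> (\<And>t s'. P t s' \<Longrightarrow> Q t s') \<Longrightarrow> wp c Q s"
  unfolding wp_def by blast

lemmas wp_rules = wp_Skip wp_Assign wp_Store wp_Seq wp_Cond

text \<open>Naming the state after each step avoids the exponential growth of nested state updates.\<close>

lemma wp_Assign_state:
  "(\<And>s'. reg s' = (reg s)(x := aval e s) \<Longrightarrow> arr s' = arr s \<Longrightarrow> Q (1 + acost e) s') \<Longrightarrow>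
    wp (Assign x e) Q s"
  by (rule wp_Assign) simp

lemma wp_Store_state:
  "(\<And>s'. reg s' = reg s \<Longrightarrow> arr s' = (arr s)(a := (arr s a)(aval i s := aval e s)) \<Longrightarrow>
      Q (1 + acost i + acost e) s') \<Longrightarrow>
    wp (Store a i e) Q s"
  by (rule wp_Store) simp

lemmas wp_state_rules = wp_Skip wp_Assign_state wp_Store_state wp_Seq wp_Cond

text \<open>The parameter \<open>m\<close> of the invariant is a potential that pays for the remaining iterations.\<close>

lemma wp_While:
  assumes "Inv m s"
    and step: "\<And>m s. Inv m s \<Longrightarrow> bval b s \<Longrightarrow>
      wp c (\<lambda>t s'. \<exists>m'. Inv m' s' \<and> 1 + bcost b + t + m' \<le> m) s"
  shows "wp (While b c) (\<lambda>t s'. \<exists>m'. Inv m' s' \<and> \<not> bval b s' \<and> t + m' \<le> m + 1 + bcost b) s"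
  using assms(1)
\<comment> \<open>Each round spends at least the 1 for its test, so the potential strictly
  decreases; the same induction yields termination and the time bound. The last, failing test is
  paid for by the extra \<open>1 + bcost b\<close>.\<close>
proof (induction m arbitrary: s rule: less_induct)
  case (less m)
  show ?case
  proof (cases "bval b s")
    case True
    obtain t s' m' where 1: "exec c s t s'" "Inv m' s'" "1 + bcost b + t + m' \<le> m"
      using step[OF less.prems True] unfolding wp_def by blast
    then obtain t2 s2 m2 where 2: "exec (While b c) s' t2 s2" "Inv m2 s2" "\<not> bval b s2"
      "t2 + m2 \<le> m' + 1 + bcost b"
      using less.IH[of m' s'] unfolding wp_def by auto
    have "exec (While b c) s (1 + bcost b + t + t2) s2"
      using exec.While_true[OF True 1(1) 2(1)] .
    moreover have "1 + bcost b + t + t2 + m2 \<le> m + 1 + bcost b" using 1(3) 2(4) by linarith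
    ultimately show ?thesis using 2 unfolding wp_def by blast
  next
    case False
    from exec.While_false[OF this, of c] less.prems False show ?thesis
      unfolding wp_def by fastforce
  qed
qed

text \<open>The 8 is 4 for the test and 4 for the increment; the 6 is 2 for the initial assignment
  and 4 for the failing test. \<open>J\<close> is required in the state in which the counter has
  already been advanced.\<close>

lemma wp_for_nodes:
  assumes n: "reg s rN = n" and init: "J 0 (s\<lparr>reg := (reg s)(rI := 0)\<rparr>)"
    and step: "\<And>i s. i < n \<Longrightarrow> J i s \<Longrightarrow> reg s rI = i \<Longrightarrow> reg s rN = n \<Longrightarrow>
      wp c (\<lambda>t s'. t \<le> K \<and> reg s' rI = i \<and> reg s' rN = n \<and>
        J (Suc i) (s'\<lparr>reg := (reg s')(rI := Suc i)\<rparr>)) s"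
  shows "wp (for_nodes c) (\<lambda>t s'. t \<le> (K + 8) * n + 6 \<and> reg s' rN = n \<and> J n s') s"
proof -
  define Inv where "Inv m s \<longleftrightarrow> reg s rN = n \<and> reg s rI \<le> n \<and> J (reg s rI) s \<and>
    m = (K + 8) * (n - reg s rI)" for m s
  have body: "wp (c ;; inc rI) (\<lambda>t s'. \<exists>m'. Inv m' s' \<and>
      1 + bcost (Less (Reg rI) (Reg rN) :: (register, array) bexp) + t + m' \<le> m) s"
    if "Inv m s" "bval (Less (Reg rI) (Reg rN)) s" for m s
  proof -
    have lt: "reg s rI < n" using that by (simp add: Inv_def)
    then have "n - reg s rI = Suc (n - Suc (reg s rI))" by simp
    with that have m: "m = (K + 8) * (n - Suc (reg s rI)) + K + 8" by (simp add: Inv_def)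
    show ?thesis
      by (intro wp_rules wp_mono[OF step[OF lt]])
        (use that lt m in \<open>auto simp: Inv_def\<close>)
  qed
  have start: "Inv ((K + 8) * n) (s\<lparr>reg := (reg s)(rI := 0)\<rparr>)"
    using n init by (simp add: Inv_def)
  show ?thesis
    unfolding for_nodes_def
    by (intro wp_rules wp_mono[OF wp_While[where Inv = Inv, OF _ body]]) (use start in \<open>auto simp: Inv_def\<close>)
qed

text \<open>A round adds 7 for the test and 4 for the increment to the cost of the body; the final
  11 covers the initial assignment (3) and the failing test (7). The hypothesis on
  \<open>aOff\<close> keeps the upper limit, which is read again in each test, constant.\<close>

lemma wp_for_neighbors:
  assumes lo: "arr s aOff (reg s rT) = lo" and hi: "arr s aOff (Suc (reg s rT)) = hi" and "lo \<le> hi"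
    and init: "J lo (s\<lparr>reg := (reg s)(rK := lo)\<rparr>)"
    and hi': "\<And>k s. J k s \<Longrightarrow> arr s aOff (Suc (reg s rT)) = hi"
    and step: "\<And>k s. lo \<le> k \<Longrightarrow> k < hi \<Longrightarrow> J k s \<Longrightarrow> reg s rK = k \<Longrightarrow>
      wp c (\<lambda>t s'. t \<le> K \<and> reg s' rK = k \<and> J (Suc k) (s'\<lparr>reg := (reg s')(rK := Suc k)\<rparr>)) s"
  shows "wp (for_neighbors c) (\<lambda>t s'. t \<le> (K + 11) * (hi - lo) + 11 \<and> J hi s') s"
proof -
  let ?b = "Less (Reg rK) (Arr aOff (Add (Reg rT) (Const 1))) :: (register, array) bexp"
  define Inv where "Inv m s \<longleftrightarrow> lo \<le> reg s rK \<and> reg s rK \<le> hi \<and> J (reg s rK) s \<and>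
    m = (K + 11) * (hi - reg s rK)" for m s
  have body: "wp (c ;; inc rK) (\<lambda>t s'. \<exists>m'. Inv m' s' \<and> 1 + bcost ?b + t + m' \<le> m) s"
    if "Inv m s" "bval ?b s" for m s
  proof -
    have lt: "lo \<le> reg s rK" "reg s rK < hi" using that hi' by (auto simp: Inv_def)
    then have "hi - reg s rK = Suc (hi - Suc (reg s rK))" by simp
    with that have m: "m = (K + 11) * (hi - Suc (reg s rK)) + K + 11" by (simp add: Inv_def)
    show ?thesis
      by (intro wp_rules wp_mono[OF step[OF lt]])
        (use that lt m in \<open>auto simp: Inv_def\<close>)
  qed
  have start: "Inv ((K + 11) * (hi - lo)) (s\<lparr>reg := (reg s)(rK := lo)\<rparr>)"
    using init \<open>lo \<le> hi\<close> by (simp add: Inv_def)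
  show ?thesis
    unfolding for_neighbors_def
    by (intro wp_rules wp_mono[OF wp_While[where Inv = Inv, OF _ body]])
      (use start lo hi' in \<open>auto simp: Inv_def\<close>)
qed

section \<open>The machine representation\<close>

definition keeps :: "(register, array) state \<Rightarrow> (register, array) state \<Rightarrow> bool" where
  "keeps s0 s \<longleftrightarrow> reg s rN = reg s0 rN \<and>
     (\<forall>a \<in> {aOff, aNbr, aTyp, aX, aY, aI, aR}. arr s a = arr s0 a)"

lemma type_code_inject [simp]: "type_code e = type_code f \<longleftrightarrow> e = f"
  by (cases e; cases f) auto

lemma type_code_less: "type_code e < 4"
  by (cases e) auto

lemma UNIV_edge_type: "UNIV = {To, From, Undir, Bidir}"
  using edge_type.exhaust by blast

section \<open>Counting adjacency list entries\<close>

lemma card_pairs_le: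
  assumes "finite U" and "\<forall>e \<in> U. card e = 2"
  shows "finite {(u, v). {u, v} \<in> U} \<and> card {(u, v). {u, v} \<in> U} \<le> 2 * card U"
proof -
  have 1: "finite {(u, v). {u, v} = e} \<and> card {(u, v). {u, v} = e} \<le> 2" if "e \<in> U" for e :: "'a set"
  proof -
    have "card e = 2" using assms(2) that by blast
    then obtain a b where "e = {a, b}" by (auto simp: card_2_iff)
    then have sub: "{(u, v). {u, v} = e} \<subseteq> {(a, b), (b, a)}" by (auto simp: doubleton_eq_iff)
    have two: "card {x, y} \<le> 2" for x y :: "'a \<times> 'a" by (simp add: card_insert_if)
    have "card {(u, v). {u, v} = e} \<le> card {(a, b), (b, a)}" by (rule card_mono[OF _ sub]) simp
    also note two
    finally show ?thesis using finite_subset[OF sub] by blast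
  qed
  have eq: "{(u, v). {u, v} \<in> U} = (\<Union>e \<in> U. {(u, v). {u, v} = e})" by auto
  have "card (\<Union>e \<in> U. {(u, v). {u, v} = e}) \<le> (\<Sum>e \<in> U. card {(u, v). {u, v} = e})"
    by (rule card_UN_le[OF assms(1)])
  also have "\<dots> \<le> (\<Sum>e \<in> U. 2)" using 1 by (intro sum_mono) auto
  finally show ?thesis unfolding eq using 1 assms(1) by simp
qed

text \<open>Each edge is read once from either end: a directed edge as \<open>To\<close> and as
  \<open>From\<close>, the symmetric ones as two ordered pairs with the same set of ends.\<close>

lemma edge_ends_bound:
  assumes "mixed_graph G"
  shows "finite {(u, t, v). edge G u t v} \<and> card {(u, t, v). edge G u t v} \<le> 2 * num_edges G"
proof -
  let ?U = "{(u, v). {u, v} \<in> undirected G}" and ?B = "{(u, v). {u, v} \<in> bidirected G}"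
  let ?S = "(\<lambda>(u, v). (u, To, v)) ` directed G \<union> (\<lambda>(u, v). (v, From, u)) ` directed G \<union>
    (\<lambda>(u, v). (u, Undir, v)) ` ?U \<union> (\<lambda>(u, v). (u, Bidir, v)) ` ?B"
  have fV: "finite (verts G)" and V: "\<forall>e \<in> undirected G \<union> bidirected G. e \<subseteq> verts G \<and> card e = 2"
    and "directed G \<subseteq> verts G \<times> verts G"
    using assms by (auto simp: mixed_graph_def)
  then have fD: "finite (directed G)" by (meson finite_SigmaI finite_subset)
  have "undirected G \<subseteq> Pow (verts G)" "bidirected G \<subseteq> Pow (verts G)" using V by blast+
  then have fU: "finite (undirected G)" and fB: "finite (bidirected G)"
    using fV by (meson finite_Pow_iff finite_subset)+
  have U: "finite ?U \<and> card ?U \<le> 2 * card (undirected G)"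
    by (rule card_pairs_le[OF fU]) (use V in blast)
  have B: "finite ?B \<and> card ?B \<le> 2 * card (bidirected G)"
    by (rule card_pairs_le[OF fB]) (use V in blast)
  have "edge G u t v \<Longrightarrow> (u, t, v) \<in> ?S" for u t v by (cases t) (force simp: edge.simps)+
  then have sub: "{(u, t, v). edge G u t v} \<subseteq> ?S" by auto
  have fS: "finite ?S" using fD U B by blast
  have "card ?S \<le> card (directed G) + card (directed G) + card ?U + card ?B"
    by (intro order.trans[OF card_Un_le] add_mono card_image_le fD) (use U B in auto)
  then have "card ?S \<le> 2 * num_edges G" using U B by (simp add: num_edges_def)
  with sub fS show ?thesis by (meson card_mono finite_subset order.trans)
qed

locale encoded_instance =
  fixes G :: "'v mixed_graph" and X Y I R :: "'v set" and \<nu> :: "nat \<Rightarrow> 'v"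
    and s0 :: "(register, array) state" and n :: nat
  assumes inst: "find_sep_instance G X Y I R" and enc: "encodes_input G X Y I R \<nu> s0"
    and n_def: "n = card (verts G)"
begin

abbreviation off :: "nat \<Rightarrow> nat" where "off \<equiv> arr s0 aOff"
abbreviation nbr :: "nat \<Rightarrow> nat" where "nbr \<equiv> arr s0 aNbr"
abbreviation ety :: "nat \<Rightarrow> nat" where "ety \<equiv> arr s0 aTyp"

lemma n_reg: "reg s0 rN = n"
  using enc by (simp add: encodes_input_def encodes_graph_def n_def)

lemma nu_bij: "bij_betw \<nu> {..<n} (verts G)"
  using enc by (simp add: encodes_input_def encodes_graph_def n_def)

lemma nu_inj: "i < n \<Longrightarrow> j < n \<Longrightarrow> \<nu> i = \<nu> j \<longleftrightarrow> i = j"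
  using nu_bij by (auto simp: bij_betw_def inj_on_def)

lemma nu_surj: "v \<in> verts G \<Longrightarrow> \<exists>i < n. v = \<nu> i"
  using nu_bij by (auto simp: bij_betw_def)

lemma input_sets:
  assumes "i < n"
  shows "arr s0 aX i = (if \<nu> i \<in> X then 1 else 0)" "arr s0 aY i = (if \<nu> i \<in> Y then 1 else 0)"
    "arr s0 aI i = (if \<nu> i \<in> I then 1 else 0)" "arr s0 aR i = (if \<nu> i \<in> R then 1 else 0)"
  using enc assms by (auto simp: encodes_input_def encodes_set_def n_def)

lemma off_mono: "i < n \<Longrightarrow> off i \<le> off (Suc i)"
  using enc by (simp add: encodes_input_def encodes_graph_def n_def)

lemma nbr_bij: "i < n \<Longrightarrow> bij_betw (\<lambda>k. (ety k, nbr k)) {off i..<off (Suc i)}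
    {(type_code t, j) | t j. j < n \<and> edge G (\<nu> i) t (\<nu> j)}"
  using enc by (simp add: encodes_input_def encodes_graph_def n_def)

lemma entry:
  assumes "i < n" "off i \<le> k" "k < off (Suc i)"
  obtains f where "ety k = type_code f" "nbr k < n" "edge G (\<nu> i) f (\<nu> (nbr k))"
proof -
  have "(ety k, nbr k) \<in> (\<lambda>k. (ety k, nbr k)) ` {off i..<off (Suc i)}" using assms(2,3) by simp
  also have "\<dots> = {(type_code t, j) | t j. j < n \<and> edge G (\<nu> i) t (\<nu> j)}"
    using nbr_bij[OF assms(1)] by (simp add: bij_betw_def)
  finally show ?thesis using that by auto
qed

lemma entry_of_edge:
  assumes "i < n" "j < n" "edge G (\<nu> i) t (\<nu> j)"
  shows "\<exists>k. off i \<le> k \<and> k < off (Suc i) \<and> ety k = type_code t \<and> nbr k = j"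
proof -
  have "(type_code t, j) \<in> (\<lambda>k. (ety k, nbr k)) ` {off i..<off (Suc i)}"
    using nbr_bij[OF assms(1)] assms by (auto simp: bij_betw_def)
  then show ?thesis by auto
qed

lemma mixed: "mixed_graph G"
  using inst by (simp add: find_sep_instance_def ancestral_graph_def)

lemma sum_deg: "(\<Sum>i<n. off (Suc i) - off i) \<le> 2 * num_edges G"
proof -
  let ?N = "\<lambda>i. {(type_code t, j) | t j. j < n \<and> edge G (\<nu> i) t (\<nu> j)}"
  have card: "off (Suc i) - off i = card (?N i)" and fin: "finite (?N i)" if "i < n" for i
    using bij_betw_same_card[OF nbr_bij[OF that]] bij_betw_finite[OF nbr_bij[OF that]] by auto
  have "(\<Sum>i<n. off (Suc i) - off i) = (\<Sum>i<n. card (?N i))" using card by simp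
  also have "\<dots> = card (SIGMA i:{..<n}. ?N i)" using fin by (subst card_SigmaI) auto
  also have "\<dots> \<le> card {(u, t, v). edge G u t v}"
  proof (rule card_inj_on_le)
    \<comment> \<open>The \<open>THE\<close> term decodes a stored type; it is well defined because
      \<open>type_code\<close> is injective.\<close>
    show "inj_on (\<lambda>(i, c, j). (\<nu> i, (THE t. type_code t = c), \<nu> j)) (SIGMA i:{..<n}. ?N i)"
      by (rule inj_onI) (auto simp: nu_inj)
    show "(\<lambda>(i, c, j). (\<nu> i, (THE t. type_code t = c), \<nu> j)) ` (SIGMA i:{..<n}. ?N i) \<subseteq> {(u, t, v). edge G u t v}"
      by auto
    show "finite {(u, t, v). edge G u t v}" using edge_ends_bound[OF mixed] by blast
  qed
  also have "\<dots> \<le> 2 * num_edges G" using edge_ends_bound[OF mixed] by blast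
  finally show ?thesis .
qed

sublocale ancestral G
  using inst by unfold_locales (simp add: find_sep_instance_def)

section \<open>The search for anteriors\<close>

definition sources :: "nat set" where
  "sources = {i. i < n \<and> \<nu> i \<in> X \<union> Y \<union> I}"

definition anteriors :: "nat set" where
  "anteriors = {i. i < n \<and> \<nu> i \<in> Ant G (X \<union> Y \<union> I)}"

definition preds :: "nat \<Rightarrow> nat set" where
  "preds i = {j. j < n \<and> anterior_step G (\<nu> j) (\<nu> i)}"

text \<open>The list \<open>st\<close> is the stack from bottom to top, so a push appends at its
  end. Only the value 1 counts as a mark.\<close>

definition marking :: "(register, array) state \<Rightarrow> nat set \<Rightarrow> nat list \<Rightarrow> bool" where
  "marking s M st \<longleftrightarrow> (\<forall>i < n. arr s aAnt i = 1 \<longleftrightarrow> i \<in> M) \<and>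
     map (arr s aStack) [0..<reg s rTop] = st"

text \<open>\<open>M - set st\<close> is the set of nodes that have left the stack. As
  \<open>st\<close> is distinct, removing its top adds exactly one node to this set.\<close>

definition sound_marking :: "nat set \<Rightarrow> nat list \<Rightarrow> bool" where
  "sound_marking M st \<longleftrightarrow> distinct st \<and> set st \<subseteq> M \<and> sources \<subseteq> M \<and> M \<subseteq> anteriors"

lemma edge_From_iff: "edge G u From v \<longleftrightarrow> edge G v To u"
  by (simp add: edge.simps)

lemma edge_Undir_iff: "edge G u Undir v \<longleftrightarrow> edge G v Undir u"
  by (simp add: edge.simps insert_commute)

lemma VXYI: "X \<union> Y \<union> I \<subseteq> verts G"
  using inst by (auto simp: find_sep_instance_def)

lemma sources_subset: "sources \<subseteq> anteriors"
  using subset_Ant[OF VXYI] by (auto simp: sources_def anteriors_def)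

lemma preds_anteriors: "i \<in> anteriors \<Longrightarrow> preds i \<subseteq> anteriors"
  unfolding anteriors_def preds_def using Ant_step by blast

text \<open>Completeness of the search: an anterior path is followed backwards from its end, which
  is a source.\<close>

lemma anteriors_subset_closed:
  assumes "sources \<subseteq> M" and "\<And>i. i \<in> M \<Longrightarrow> preds i \<subseteq> M"
  shows "anteriors \<subseteq> M"
proof -
  have "\<forall>i < n. v = \<nu> i \<longrightarrow> i \<in> M"
    if "(anterior_step G)\<^sup>*\<^sup>* v w" "w \<in> X \<union> Y \<union> I" for v w
    using that
  proof (induction rule: converse_rtranclp_induct)
    case base
    then show ?case using assms(1) by (auto simp: sources_def)
  next
    case (step v u)
    have "u \<in> verts G" using step(1) edge_verts by blast
    then obtain j where "j < n" "u = \<nu> j" using nu_surj by blast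
    with step have "j \<in> M" by blast
    with step(1) \<open>u = \<nu> j\<close> assms(2)[OF this] show ?case by (auto simp: preds_def)
  qed
  then show ?thesis by (auto simp: anteriors_def Ant_def anterior_iff)
qed

lemma wp_mark_sources:
  assumes "keeps s0 s" and "reg s rTop = 0"
  shows "wp (for_nodes
       (Cond (Or (is_set aX rI) (Or (is_set aY rI) (is_set aI rI)))
          (Store aAnt (Reg rI) (Const 1) ;;
           Store aStack (Reg rTop) (Reg rI) ;;
           inc rTop)
          (Store aAnt (Reg rI) (Const 0))))
    (\<lambda>t s'. t \<le> 50 * n + 6 \<and> keeps s0 s' \<and>
      marking s' sources (filter (\<lambda>j. j \<in> sources) [0..<n])) s"
proof -
  define J where "J i s \<longleftrightarrow> keeps s0 s \<and> (\<forall>j < i. arr s aAnt j = 1 \<longleftrightarrow> j \<in> sources) \<and>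
     map (arr s aStack) [0..<reg s rTop] = filter (\<lambda>j. j \<in> sources) [0..<i]" for i s
  have N: "reg s rN = n" using assms(1) n_reg by (simp add: keeps_def)
  show ?thesis
  \<comment> \<open>The 42 is a generous allowance for the body; with the 8 of the loop a round
    costs 50.\<close>
  proof (rule wp_mono[OF wp_for_nodes[where J = J and K = 42, OF N]])
    show "J 0 (s\<lparr>reg := (reg s)(rI := 0)\<rparr>)" using assms by (simp add: J_def keeps_def)
  next
    fix i s
    assume i: "i < n" and J: "J i s" and r: "reg s rI = i" "reg s rN = n"
    have src: "i \<in> sources \<longleftrightarrow> arr s aX i = 1 \<or> arr s aY i = 1 \<or> arr s aI i = 1"
      using J input_sets[OF i] i by (auto simp: J_def keeps_def sources_def)
    show "wp (Cond (Or (is_set aX rI) (Or (is_set aY rI) (is_set aI rI)))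
          (Store aAnt (Reg rI) (Const 1) ;;
           Store aStack (Reg rTop) (Reg rI) ;;
           inc rTop)
          (Store aAnt (Reg rI) (Const 0)))
       (\<lambda>t s'. t \<le> 42 \<and> reg s' rI = i \<and> reg s' rN = n \<and>
         J (Suc i) (s'\<lparr>reg := (reg s')(rI := Suc i)\<rparr>)) s"
      by (intro wp_rules) (use J src r in \<open>auto simp: J_def keeps_def less_Suc_eq\<close>)
  qed (auto simp: J_def marking_def)
qed

definition mark_neighbors :: program where
  "mark_neighbors = for_neighbors
     (rF ::= Arr aTyp (Reg rK) ;;
      rNb ::= Arr aNbr (Reg rK) ;;
      Cond (And (Or (has_type rF From) (has_type rF Undir)) (Neg (is_set aAnt rNb)))
        (Store aAnt (Reg rNb) (Const 1) ;;
         Store aStack (Reg rTop) (Reg rNb) ;;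
         inc rTop)
        Skip)"

text \<open>It is applied after \<open>i\<close> has been popped. Every node found is both marked
  and pushed, so \<open>M - set st\<close> does not change while the list is scanned; this is what
  leaves the potential of the outer loop untouched.\<close>

lemma wp_mark_neighbors:
  assumes s: "keeps s0 s" "reg s rT = i" "marking s M st" and i: "i < n" "i \<in> M"
    and sound: "sound_marking M st"
  shows "wp mark_neighbors (\<lambda>t s'. t \<le> 50 * (off (Suc i) - off i) + 11 \<and> keeps s0 s' \<and>
    (\<exists>M' st'. marking s' M' st' \<and> sound_marking M' st' \<and> M \<subseteq> M' \<and>
       M' - set st' = M - set st \<and> preds i \<subseteq> M')) s"
proof -
  define J where "J k s \<longleftrightarrow> keeps s0 s \<and> reg s rT = i \<and>
     (\<exists>M' st'. marking s M' st' \<and> sound_marking M' st' \<and> M \<subseteq> M' \<and> M' - set st' = M - set st \<and>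
       (\<forall>k'. off i \<le> k' \<and> k' < k \<and> (ety k' = type_code From \<or> ety k' = type_code Undir) \<longrightarrow>
         nbr k' \<in> M'))" for k s
  show ?thesis unfolding mark_neighbors_def
  proof (rule wp_mono[OF wp_for_neighbors[where J = J and K = 39 and lo = "off i" and hi = "off (Suc i)"]])
    show "arr s aOff (reg s rT) = off i" "arr s aOff (Suc (reg s rT)) = off (Suc i)"
      using s by (auto simp: keeps_def)
    show "off i \<le> off (Suc i)" using off_mono[OF i(1)] .
    show "J (off i) (s\<lparr>reg := (reg s)(rK := off i)\<rparr>)"
      using s sound unfolding J_def marking_def by (auto simp: keeps_def)
    show "arr s aOff (Suc (reg s rT)) = off (Suc i)" if "J k s" for k s
      using that by (auto simp: J_def keeps_def)
  next
    fix k s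
    assume k: "off i \<le> k" "k < off (Suc i)" and J: "J k s" and r: "reg s rK = k"
    obtain M' st' where m: "marking s M' st'" "sound_marking M' st'" "M \<subseteq> M'"
      "M' - set st' = M - set st" and
      seen: "\<And>k'. off i \<le> k' \<Longrightarrow> k' < k \<Longrightarrow> ety k' = type_code From \<or> ety k' = type_code Undir \<Longrightarrow>
         nbr k' \<in> M'" and ks: "keeps s0 s" "reg s rT = i"
      using J unfolding J_def by blast
    obtain f where f: "ety k = type_code f" "nbr k < n" "edge G (\<nu> i) f (\<nu> (nbr k))"
      using entry[OF i(1) k] .
    have a: "arr s aTyp = ety" "arr s aNbr = nbr" using ks by (auto simp: keeps_def)
    have mk: "arr s aAnt (nbr k) = 1 \<longleftrightarrow> nbr k \<in> M'" using m(1) f(2) by (simp add: marking_def)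
    show "wp (rF ::= Arr aTyp (Reg rK) ;;
      rNb ::= Arr aNbr (Reg rK) ;;
      Cond (And (Or (has_type rF From) (has_type rF Undir)) (Neg (is_set aAnt rNb)))
        (Store aAnt (Reg rNb) (Const 1) ;;
         Store aStack (Reg rTop) (Reg rNb) ;;
         inc rTop)
        Skip) (\<lambda>t s'. t \<le> 39 \<and> reg s' rK = k \<and> J (Suc k) (s'\<lparr>reg := (reg s')(rK := Suc k)\<rparr>)) s"
    proof (intro wp_rules, goal_cases)
      case 1
      then have new: "nbr k \<notin> M'" and ft: "f = From \<or> f = Undir"
        using mk r a f(1) by (auto simp del: type_code.simps)
      have "nbr k \<in> preds i"
        using f(2,3) ft by (auto simp: preds_def edge_From_iff edge_Undir_iff)
      moreover have "i \<in> anteriors" using m i by (auto simp: sound_marking_def)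
      ultimately have "nbr k \<in> anteriors" using preds_anteriors by blast
      then have "sound_marking (insert (nbr k) M') (st' @ [nbr k])"
        using m(2) new by (auto simp: sound_marking_def)
      moreover have "insert (nbr k) M' - set (st' @ [nbr k]) = M - set st"
        using m(4) new by auto
      moreover have "M \<subseteq> insert (nbr k) M'" using m(3) by auto
      moreover have "off i \<le> k' \<and> k' < Suc k \<and> (ety k' = type_code From \<or> ety k' = type_code Undir) \<longrightarrow>
         nbr k' \<in> insert (nbr k) M'" for k'
        using seen[of k'] by (auto simp: less_Suc_eq)
      ultimately show ?case
        using r a m(1) ks unfolding J_def
        by (intro conjI exI[of _ "insert (nbr k) M'"] exI[of _ "st' @ [nbr k]"])
          (auto simp: keeps_def marking_def)
    next
      case 2
      then have "ety k = type_code From \<or> ety k = type_code Undir \<Longrightarrow> nbr k \<in> M'"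
        using mk r a f(1) by (auto simp del: type_code.simps)
      then have "off i \<le> k' \<and> k' < Suc k \<and> (ety k' = type_code From \<or> ety k' = type_code Undir) \<longrightarrow>
         nbr k' \<in> M'" for k'
        using seen[of k'] by (auto simp: less_Suc_eq simp del: type_code.simps)
      then show ?case
        using r a m ks unfolding J_def
        by (intro conjI exI[of _ "M'"] exI[of _ "st'"])
          (auto simp: keeps_def marking_def simp del: type_code.simps)
    qed
  next
    fix t s'
    assume "t \<le> (39 + 11) * (off (Suc i) - off i) + 11 \<and> J (off (Suc i)) s'"
    then obtain M' st' where t: "t \<le> (39 + 11) * (off (Suc i) - off i) + 11" and
      m: "marking s' M' st'" "sound_marking M' st'" "M \<subseteq> M'"
      "M' - set st' = M - set st" and
      seen: "\<And>k'. off i \<le> k' \<Longrightarrow> k' < off (Suc i) \<Longrightarrow>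
         ety k' = type_code From \<or> ety k' = type_code Undir \<Longrightarrow> nbr k' \<in> M'" and ks: "keeps s0 s'"
      unfolding J_def by blast
    have "j \<in> M'" if "j \<in> preds i" for j
    proof -
      have j: "j < n" and "edge G (\<nu> i) From (\<nu> j) \<or> edge G (\<nu> i) Undir (\<nu> j)"
        using that by (auto simp: preds_def edge_From_iff edge_Undir_iff)
      then obtain f where "edge G (\<nu> i) f (\<nu> j)" "f = From \<or> f = Undir" by blast
      with entry_of_edge[OF i(1) j, of f] seen show ?thesis by metis
    qed
    with t m ks show "t \<le> 50 * (off (Suc i) - off i) + 11 \<and> keeps s0 s' \<and>
    (\<exists>M' st'. marking s' M' st' \<and> sound_marking M' st' \<and> M \<subseteq> M' \<and>
       M' - set st' = M - set st \<and> preds i \<subseteq> M')"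
      by (intro conjI exI[of _ M'] exI[of _ st']) auto
  qed
qed

text \<open>The price of removing node \<open>i\<close>: the pop, the loop test and the scan of its
  list, rounded up.\<close>

definition weight :: "nat \<Rightarrow> nat" where
  "weight i = 50 + 100 * (off (Suc i) - off i)"

lemma sum_weight: "(\<Sum>i<n. weight i) \<le> 50 * n + 200 * num_edges G"
  using sum_deg by (simp add: weight_def sum.distrib flip: sum_distrib_left)

lemma wp_anteriors:
  assumes "keeps s0 s"
  shows "wp anteriors_program (\<lambda>t s'. t \<le> 100 * n + 200 * num_edges G + 30 \<and> keeps s0 s' \<and>
    (\<forall>i < n. arr s' aAnt i = 1 \<longleftrightarrow> \<nu> i \<in> Ant G (X \<union> Y \<union> I))) s"
proof -
  \<comment> \<open>The potential is the weight of all nodes that have not been removed from the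
    stack, marked or not. Pushing leaves it unchanged, and popping lowers it by the weight of the
    popped node.\<close>
  define Inv where "Inv m s \<longleftrightarrow> keeps s0 s \<and> (\<exists>M st. marking s M st \<and> sound_marking M st \<and>
    (\<forall>i \<in> M - set st. preds i \<subseteq> M) \<and> m = sum weight ({..<n} - (M - set st)))" for m s
  have body: "wp (dec rTop ;; rT ::= Arr aStack (Reg rTop) ;; mark_neighbors)
      (\<lambda>t s'. \<exists>m'. Inv m' s' \<and>
        1 + bcost (Less (Const 0) (Reg rTop) :: (register, array) bexp) + t + m' \<le> m) s"
    if inv: "Inv m s" and b: "bval (Less (Const 0) (Reg rTop)) s" for m s
  proof -
    obtain M st where m: "marking s M st" "sound_marking M st" "\<And>i. i \<in> M - set st \<Longrightarrow> preds i \<subseteq> M"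
      "m = sum weight ({..<n} - (M - set st))" and ks: "keeps s0 s"
      using inv unfolding Inv_def by blast
    obtain top where top: "reg s rTop = Suc top" using b by (cases "reg s rTop") auto
    define i where "i = arr s aStack top"
    define st1 where "st1 = map (arr s aStack) [0..<top]"
    have st: "st = st1 @ [i]" using m(1) top by (simp add: marking_def st1_def i_def)
    have iM: "i \<in> M" "i \<notin> set st1" and sm: "sound_marking M st1"
      using m(2) by (auto simp: sound_marking_def st)
    have i: "i < n" using iM m(2) by (auto simp: sound_marking_def anteriors_def)
    have D: "M - set st1 = insert i (M - set st)" using iM by (auto simp: st)
    have "{..<n} - (M - set st) = insert i ({..<n} - (M - set st1))" using i iM by (auto simp: st)
    then have w: "m = weight i + sum weight ({..<n} - (M - set st1))" using m(4) iM by simp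
    let ?s = "s\<lparr>reg := (reg s)(rTop := top, rT := i)\<rparr>"
    have "keeps s0 ?s" "reg ?s rT = i" "marking ?s M st1"
      using ks m(1) by (auto simp: keeps_def marking_def st1_def)
    note nb = wp_mark_neighbors[OF this i iM(1) sm]
    show ?thesis
    proof (intro wp_rules, simp add: top flip: i_def, rule wp_mono[OF nb], goal_cases)
      case (1 t s')
      then obtain M' st' where t: "t \<le> 50 * (off (Suc i) - off i) + 11" and
        m': "marking s' M' st'" "sound_marking M' st'" "M \<subseteq> M'"
        "M' - set st' = M - set st1" "preds i \<subseteq> M'" and ks': "keeps s0 s'"
        by blast
      have "preds j \<subseteq> M'" if "j \<in> M' - set st'" for j
      proof (cases "j = i")
        case False
        then have "j \<in> M - set st" using that m'(4) D by auto
        from m(3)[OF this] m'(3) show ?thesis by auto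
      qed (use m'(5) in simp)
      with m' ks' have "Inv (sum weight ({..<n} - (M - set st1))) s'"
        unfolding Inv_def by (intro conjI exI[of _ M'] exI[of _ st'] ballI) simp_all
      then show ?case
        by (intro exI[of _ "sum weight ({..<n} - (M - set st1))"] conjI) (use t w in \<open>simp_all add: weight_def\<close>)
    qed
  qed
  have final: "\<forall>i < n. arr s aAnt i = 1 \<longleftrightarrow> \<nu> i \<in> Ant G (X \<union> Y \<union> I)"
    if inv: "Inv m s" and empty: "reg s rTop = 0" for m s
  proof -
    obtain M st where m: "marking s M st" "sound_marking M st" "\<forall>i \<in> M - set st. preds i \<subseteq> M"
      using inv unfolding Inv_def by blast
    moreover have "st = []" using m(1) empty by (simp add: marking_def)
    ultimately have "M = anteriors" using anteriors_subset_closed[of M] by (auto simp: sound_marking_def)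
    with m(1) show ?thesis by (auto simp: marking_def anteriors_def)
  qed
  have start: "Inv (sum weight ({..<n} - (sources - set (filter (\<lambda>j. j \<in> sources) [0..<n])))) s"
    if "keeps s0 s" "marking s sources (filter (\<lambda>j. j \<in> sources) [0..<n])" for s
    unfolding Inv_def
    using that sources_subset
    by (intro conjI exI[of _ sources] exI[of _ "filter (\<lambda>j. j \<in> sources) [0..<n]"])
      (auto simp: sound_marking_def sources_def)
  \<comment> \<open>At the start every marked node is on the stack, so the potential is the weight
    of all nodes.\<close>
  have S: "sources - set (filter (\<lambda>j. j \<in> sources) [0..<n]) = {}" by (auto simp: sources_def)
  show ?thesis
    unfolding anteriors_program_def mark_neighbors_def[symmetric]
  proof (intro wp_rules, rule wp_mono[OF wp_mark_sources], goal_cases)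
    case (3 t1 s1)
    then have "Inv (sum weight {..<n}) s1" using start[of s1, unfolded S] by simp
    then show ?case
    proof (rule wp_mono[OF wp_While[where Inv = Inv, OF _ body]], goal_cases)
      case (3 t2 s2)
      then show ?case using final[of _ s2] sum_weight \<open>t1 \<le> _ \<and> _\<close> by (auto simp: Inv_def)
    qed
  qed (use assms in \<open>auto simp: keeps_def\<close>)
qed

section \<open>The separator and TestSep on the machine\<close>

declare type_code.simps [simp del]

lemma wp_separator:
  assumes "keeps s0 s" and "\<forall>i < n. arr s aAnt i = 1 \<longleftrightarrow> \<nu> i \<in> A"
  shows "wp separator_program (\<lambda>t s'. t \<le> 50 * n + 6 \<and> keeps s0 s' \<and>
    encodes_set G \<nu> (arr s' aZ) (A \<inter> (R - (X \<union> Y)))) s"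
proof -
  define J where "J i s \<longleftrightarrow> keeps s0 s \<and> (\<forall>j < n. arr s aAnt j = 1 \<longleftrightarrow> \<nu> j \<in> A) \<and>
    (\<forall>j < i. arr s aZ j = (if \<nu> j \<in> A \<inter> (R - (X \<union> Y)) then 1 else 0))" for i s
  have N: "reg s rN = n" using assms(1) n_reg by (simp add: keeps_def)
  show ?thesis unfolding separator_program_def
  proof (rule wp_mono[OF wp_for_nodes[where J = J and K = 42, OF N]])
    show "J 0 (s\<lparr>reg := (reg s)(rI := 0)\<rparr>)" using assms by (simp add: J_def keeps_def)
  next
    fix i s
    assume i: "i < n" and J: "J i s" and r: "reg s rI = i" "reg s rN = n"
    have v: "arr s aX i = (if \<nu> i \<in> X then 1 else 0)" "arr s aY i = (if \<nu> i \<in> Y then 1 else 0)"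
      "arr s aR i = (if \<nu> i \<in> R then 1 else 0)" "arr s aAnt i = 1 \<longleftrightarrow> \<nu> i \<in> A"
      using J i by (simp_all add: J_def keeps_def input_sets)
    have test: "bval (And (is_set aAnt rI) (And (is_set aR rI) (Neg (Or (is_set aX rI) (is_set aY rI))))) s \<longleftrightarrow>
        \<nu> i \<in> A \<inter> (R - (X \<union> Y))"
      using v(4) by (simp add: r v(1-3))
    show "wp (Cond (And (is_set aAnt rI)
                (And (is_set aR rI) (Neg (Or (is_set aX rI) (is_set aY rI)))))
          (Store aZ (Reg rI) (Const 1))
          (Store aZ (Reg rI) (Const 0)))
       (\<lambda>t s'. t \<le> 42 \<and> reg s' rI = i \<and> reg s' rN = n \<and>
         J (Suc i) (s'\<lparr>reg := (reg s')(rI := Suc i)\<rparr>)) s"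
    proof (intro wp_rules, goal_cases)
      case 1
      then have "\<nu> i \<in> A \<inter> (R - (X \<union> Y))" using test by blast
      then show ?case using J r by (simp add: J_def keeps_def less_Suc_eq)
    next
      case 2
      then have "\<nu> i \<notin> A \<inter> (R - (X \<union> Y))" using test by blast
      then show ?case using J r by (simp add: J_def keeps_def less_Suc_eq)
    qed
  qed (auto simp: J_def encodes_set_def n_def)
qed

section \<open>Representation of pairs and of the worklist\<close>

lemma quadruple: "x + x + (x + x) = 4 * (x :: nat)"
  by simp

lemma pair_index_inject: "4 * i + type_code e = 4 * j + type_code f \<longleftrightarrow> i = j \<and> e = f"
proof -
  have "4 * i + a = 4 * j + b \<longleftrightarrow> i = j \<and> a = b" if "a < 4" "b < 4" for a b :: nat
    using that by presburger
  then show ?thesis using type_code_less by simp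
qed

definition keeps_separator :: "'v set \<Rightarrow> (register, array) state \<Rightarrow> bool" where
  "keeps_separator Z s \<longleftrightarrow> keeps s0 s \<and> encodes_set G \<nu> (arr s aZ) Z"

definition queue ::
    "(register, array) state \<Rightarrow> (edge_type \<times> nat) set \<Rightarrow> (edge_type \<times> nat) list \<Rightarrow> bool" where
  "queue s Q st \<longleftrightarrow> (\<forall>i < n. \<forall>e. arr s aQ (4 * i + type_code e) = 1 \<longleftrightarrow> (e, i) \<in> Q) \<and>
     map (\<lambda>k. (arr s aPE k, arr s aPT k)) [0..<reg s rTop] = map (\<lambda>(e, i). (type_code e, i)) st"

lemma queue_push:
  assumes "queue s Q st" "j < n" "arr s' aQ = (arr s aQ)(4 * j + type_code f := 1)"
    "arr s' aPE = (arr s aPE)(reg s rTop := type_code f)" "arr s' aPT = (arr s aPT)(reg s rTop := j)"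
    "reg s' rTop = Suc (reg s rTop)"
  shows "queue s' (insert (f, j) Q) (st @ [(f, j)])"
proof -
  have "map (\<lambda>k. (((arr s aPE)(reg s rTop := type_code f)) k, ((arr s aPT)(reg s rTop := j)) k))
      [0..<reg s rTop] = map (\<lambda>k. (arr s aPE k, arr s aPT k)) [0..<reg s rTop]"
    by (rule map_cong) auto
  then show ?thesis
    using assms(1,2) unfolding queue_def assms(3-6) by (simp add: pair_index_inject) blast
qed

definition sound_queue :: "(edge_type \<times> nat) set \<Rightarrow> (edge_type \<times> nat) list \<Rightarrow> bool" where
  "sound_queue Q st \<longleftrightarrow> distinct st \<and> set st \<subseteq> Q \<and> Q \<subseteq> UNIV \<times> {..<n}"

definition name_pairs :: "(edge_type \<times> nat) set \<Rightarrow> (edge_type \<times> 'v) set" where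
  "name_pairs S = (\<lambda>(e, i). (e, \<nu> i)) ` S"

text \<open>Successors found in the list entries before index \<open>k\<close>, whether or not they
  belong to \<open>Q\<close>. This lets the loop invariant keep the initial \<open>Q\<close> fixed
  and describe the growing set as \<open>Q \<union> next_pairs Z e i k\<close>.\<close>

definition next_pairs :: "'v set \<Rightarrow> edge_type \<Rightarrow> nat \<Rightarrow> nat \<Rightarrow> (edge_type \<times> nat) set" where
  "next_pairs Z e i k = {(f, j). \<exists>k'. off i \<le> k' \<and> k' < k \<and> ety k' = type_code f \<and> nbr k' = j \<and>
     m_connecting Z e (\<nu> i) f}"

definition explore_neighbors :: program where
  "explore_neighbors = for_neighbors
     (rF ::= Arr aTyp (Reg rK) ;;
      rNb ::= Arr aNbr (Reg rK) ;;
      Cond (And m_connecting_test (Neg (Eq (Arr aQ (pair_index rNb (Reg rF))) (Const 1))))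
        (Store aPE (Reg rTop) (Reg rF) ;;
         Store aPT (Reg rTop) (Reg rNb) ;;
         inc rTop ;;
         Store aQ (pair_index rNb (Reg rF)) (Const 1))
        Skip)"

lemma m_connecting_test_iff:
  assumes "reg s rE = type_code e" "reg s rF = type_code f" "reg s rT = i" "i < n"
    and "encodes_set G \<nu> (arr s aZ) Z"
  shows "bval m_connecting_test s \<longleftrightarrow> m_connecting Z e (\<nu> i) f"
proof -
  have "arr s aZ i = 1 \<longleftrightarrow> \<nu> i \<in> Z" using assms(4,5) by (simp add: encodes_set_def n_def)
  with assms(1-3) show ?thesis
    by (simp add: m_connecting_test_def Let_def m_connecting_def head_at_end_def head_at_start_def)
qed

lemma bcost_m_connecting_test: "bcost m_connecting_test = 43"
  by (simp add: m_connecting_test_def Let_def)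

text \<open>The program tests against the growing set of pairs, whereas \<open>new_pairs\<close>
  refers to the set at the start of the round; a pair is pushed only when first seen, so exactly the
  pairs outside the initial \<open>Q\<close> are added. An entry costs at most 85;
  \<open>K = 89\<close> makes it 100 together with the loop.\<close>

lemma wp_explore_neighbors:
  assumes s: "keeps_separator Z s" "reg s rT = i" "reg s rE = type_code e" "reg s rAns = 1"
      "queue s Q st"
    and i: "i < n" and sound: "sound_queue Q st"
  shows "wp explore_neighbors (\<lambda>t s'. t \<le> 100 * (off (Suc i) - off i) + 11 \<and>
    keeps_separator Z s' \<and> reg s' rT = i \<and> reg s' rAns = 1 \<and>
    (\<exists>st'. queue s' (Q \<union> next_pairs Z e i (off (Suc i))) st' \<and>
       sound_queue (Q \<union> next_pairs Z e i (off (Suc i))) st' \<and>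
       set st' = set st \<union> (next_pairs Z e i (off (Suc i)) - Q))) s"
proof -
  define J where "J k s \<longleftrightarrow> keeps_separator Z s \<and> reg s rT = i \<and> reg s rE = type_code e \<and>
    reg s rAns = 1 \<and>
    (\<exists>st'. queue s (Q \<union> next_pairs Z e i k) st' \<and> sound_queue (Q \<union> next_pairs Z e i k) st' \<and>
       set st' = set st \<union> (next_pairs Z e i k - Q))" for k s
  show ?thesis unfolding explore_neighbors_def
  proof (rule wp_mono[OF wp_for_neighbors[where J = J and K = 89 and lo = "off i" and hi = "off (Suc i)"]])
    show "arr s aOff (reg s rT) = off i" "arr s aOff (Suc (reg s rT)) = off (Suc i)"
      using s by (auto simp: keeps_separator_def keeps_def)
    show "off i \<le> off (Suc i)" using off_mono[OF i] .
    have "next_pairs Z e i (off i) = {}" by (auto simp: next_pairs_def)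
    then show "J (off i) (s\<lparr>reg := (reg s)(rK := off i)\<rparr>)"
      using s sound unfolding J_def queue_def by (auto simp: keeps_separator_def keeps_def)
    show "arr s aOff (Suc (reg s rT)) = off (Suc i)" if "J k s" for k s
      using that by (auto simp: J_def keeps_separator_def keeps_def)
  next
    fix k s
    assume k: "off i \<le> k" "k < off (Suc i)" and J: "J k s" and r: "reg s rK = k"
    let ?N = "next_pairs Z e i k" and ?N' = "next_pairs Z e i (Suc k)"
    obtain st' where m: "queue s (Q \<union> ?N) st'" "sound_queue (Q \<union> ?N) st'"
      "set st' = set st \<union> (?N - Q)"
      and ks: "keeps_separator Z s" "reg s rT = i" "reg s rE = type_code e" "reg s rAns = 1"
      using J unfolding J_def by blast
    obtain f where f: "ety k = type_code f" "nbr k < n" "edge G (\<nu> i) f (\<nu> (nbr k))"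
      using entry[OF i k] .
    have a: "arr s aTyp = ety" "arr s aNbr = nbr" and Z: "encodes_set G \<nu> (arr s aZ) Z"
      using ks by (auto simp: keeps_separator_def keeps_def)
    have mk: "arr s aQ (4 * nbr k + type_code f) = 1 \<longleftrightarrow> (f, nbr k) \<in> Q \<union> ?N"
      using m(1) f(2) by (simp add: queue_def)
    have N': "?N' = (if m_connecting Z e (\<nu> i) f then insert (f, nbr k) ?N else ?N)"
      using k(1) f(1) by (auto simp: next_pairs_def less_Suc_eq)
    have test: "bval m_connecting_test s' \<longleftrightarrow> m_connecting Z e (\<nu> i) f"
      if "reg s' = (reg s)(rF := type_code f, rNb := nbr k)" "arr s' = arr s" for s'
      by (rule m_connecting_test_iff) (use that ks i Z in auto)
    show "wp (rF ::= Arr aTyp (Reg rK) ;;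
      rNb ::= Arr aNbr (Reg rK) ;;
      Cond (And m_connecting_test (Neg (Eq (Arr aQ (pair_index rNb (Reg rF))) (Const 1))))
        (Store aPE (Reg rTop) (Reg rF) ;;
         Store aPT (Reg rTop) (Reg rNb) ;;
         inc rTop ;;
         Store aQ (pair_index rNb (Reg rF)) (Const 1))
        Skip) (\<lambda>t s'. t \<le> 89 \<and> reg s' rK = k \<and> J (Suc k) (s'\<lparr>reg := (reg s')(rK := Suc k)\<rparr>)) s"
    proof (intro wp_state_rules, goal_cases)
      case (1 s1 s2 s3 s4 s5 s6)
      have s2: "reg s2 = (reg s)(rF := type_code f, rNb := nbr k)" "arr s2 = arr s"
        using 1(1-4) r a f(1) by simp_all
      have mc: "m_connecting Z e (\<nu> i) f" and new: "(f, nbr k) \<notin> Q \<union> ?N"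
        using 1(5) test[OF s2] s2 mk by (simp_all add: quadruple)
      have s6: "reg s6 = (reg s2)(rTop := Suc (reg s rTop))"
        "arr s6 aQ = (arr s aQ)(4 * nbr k + type_code f := 1)"
        "arr s6 aPE = (arr s aPE)(reg s rTop := type_code f)"
        "arr s6 aPT = (arr s aPT)(reg s rTop := nbr k)"
        "\<And>b. b \<notin> {aQ, aPE, aPT} \<Longrightarrow> arr s6 b = arr s b"
        using 1(6-13) s2 by (simp_all add: quadruple)
      let ?s6 = "s6\<lparr>reg := (reg s6)(rK := Suc k)\<rparr>"
      have eq: "Q \<union> ?N' = insert (f, nbr k) (Q \<union> ?N)" using N' mc by auto
      have "sound_queue (Q \<union> ?N') (st' @ [(f, nbr k)])"
        unfolding eq using m(2) new f(2) by (auto simp: sound_queue_def)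
      moreover have "set (st' @ [(f, nbr k)]) = set st \<union> (?N' - Q)"
        using m(3) new N' mc by auto
      moreover have "queue ?s6 (Q \<union> ?N') (st' @ [(f, nbr k)])"
        unfolding eq by (rule queue_push[OF m(1) f(2)]) (simp_all add: s6 s2)
      moreover have "keeps_separator Z ?s6"
        using ks(1) by (simp add: keeps_separator_def keeps_def s6 s2)
      ultimately have "J (Suc k) ?s6"
        unfolding J_def using ks(2-4) s6(1) s2(1) by auto
      then show ?case using r s6(1) s2(1) by (simp add: bcost_m_connecting_test)
    next
      case (2 s1 s2)
      have s2: "reg s2 = (reg s)(rF := type_code f, rNb := nbr k)" "arr s2 = arr s"
        using 2(1-4) r a f(1) by simp_all
      have "\<not> m_connecting Z e (\<nu> i) f \<or> (f, nbr k) \<in> Q \<union> ?N"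
        using 2(5) test[OF s2] s2 mk by (simp add: quadruple)
      then have eq: "Q \<union> ?N' = Q \<union> ?N" "?N' - Q = ?N - Q"
        using N' by auto
      let ?s2 = "s2\<lparr>reg := (reg s2)(rK := Suc k)\<rparr>"
      have "queue ?s2 (Q \<union> ?N) st'" using m(1) by (simp add: queue_def s2)
      moreover have "keeps_separator Z ?s2"
        using ks(1) by (simp add: keeps_separator_def keeps_def s2)
      ultimately have "J (Suc k) ?s2"
        unfolding J_def eq using ks(2-4) s2(1) m(2,3) by auto
      then show ?case using r s2(1) by (simp add: bcost_m_connecting_test)
    qed
  qed (auto simp: J_def)
qed

lemma name_pairs_inj: "inj_on (\<lambda>(e, i). (e, \<nu> i)) (UNIV \<times> {..<n})"
  by (auto simp: inj_on_def nu_inj)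

lemma name_pairs_Diff:
  "A \<subseteq> UNIV \<times> {..<n} \<Longrightarrow> B \<subseteq> UNIV \<times> {..<n} \<Longrightarrow> name_pairs (A - B) = name_pairs A - name_pairs B"
  unfolding name_pairs_def using inj_on_image_set_diff[OF name_pairs_inj] by blast

lemma next_pairs_subset: "i < n \<Longrightarrow> next_pairs Z e i (off (Suc i)) \<subseteq> UNIV \<times> {..<n}"
  unfolding next_pairs_def using entry by blast

text \<open>The adjacency list contains only edges and all of them, and \<open>\<nu>\<close> is
  injective on the indices below \<open>n\<close>, so removing \<open>Q\<close> commutes with
  replacing indices by nodes.\<close>

lemma new_pairs_eq:
  assumes i: "i < n" and Q: "Q \<subseteq> UNIV \<times> {..<n}"
  shows "new_pairs G Z (name_pairs Q) e (\<nu> i) = name_pairs (next_pairs Z e i (off (Suc i)) - Q)"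
proof -
  let ?N = "next_pairs Z e i (off (Suc i))"
  have "(f, v) \<in> name_pairs ?N \<longleftrightarrow> edge G (\<nu> i) f v \<and> m_connecting Z e (\<nu> i) f" for f v
  proof
    assume "(f, v) \<in> name_pairs ?N"
    then obtain k where k: "off i \<le> k" "k < off (Suc i)" "ety k = type_code f" "v = \<nu> (nbr k)"
      "m_connecting Z e (\<nu> i) f"
      by (auto simp: name_pairs_def next_pairs_def)
    with entry[OF i k(1,2)] show "edge G (\<nu> i) f v \<and> m_connecting Z e (\<nu> i) f" by (metis type_code_inject)
  next
    assume v: "edge G (\<nu> i) f v \<and> m_connecting Z e (\<nu> i) f"
    then obtain j where j: "j < n" "v = \<nu> j" using nu_surj edge_verts by blast
    with v entry_of_edge[OF i, of j f] have "(f, j) \<in> ?N" by (auto simp: next_pairs_def)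
    with j show "(f, v) \<in> name_pairs ?N" by (force simp: name_pairs_def)
  qed
  then have "new_pairs G Z (name_pairs Q) e (\<nu> i) = name_pairs ?N - name_pairs Q"
    by (auto simp: new_pairs_def)
  then show ?thesis using name_pairs_Diff[OF next_pairs_subset[OF i] Q] by simp
qed

lemma name_pairs_Un: "name_pairs (A \<union> B) = name_pairs A \<union> name_pairs B"
  by (simp add: name_pairs_def image_Un)

definition start_pairs :: "(edge_type \<times> nat) list" where
  "start_pairs = map (Pair From) (filter (\<lambda>j. \<nu> j \<in> X) [0..<n])"

lemma name_start_pairs: "name_pairs (set start_pairs) = {From} \<times> X"
proof -
  have "X \<subseteq> verts G" using inst by (simp add: find_sep_instance_def)
  then show ?thesis
    using nu_surj by (force simp: name_pairs_def start_pairs_def)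
qed

text \<open>\<open>aQ\<close> holds arbitrary values initially. The four resets cover every edge
  type at node \<open>i\<close> and, as pair indices are injective, do not disturb the cells of
  earlier nodes.\<close>

lemma start_marks:
  fixes a :: "nat \<Rightarrow> nat"
  assumes "\<forall>j < i. \<forall>e. a (4 * j + type_code e) = 1 \<longleftrightarrow> e = From \<and> \<nu> j \<in> X"
  defines "b \<equiv> a(4 * i + type_code To := 0, 4 * i + type_code From := 0,
    4 * i + type_code Undir := 0, 4 * i + type_code Bidir := 0)"
  shows "\<nu> i \<in> X \<Longrightarrow> \<forall>j < Suc i. \<forall>e. (b(4 * i + type_code From := 1)) (4 * j + type_code e) = 1 \<longleftrightarrow>
      e = From \<and> \<nu> j \<in> X"
    and "\<nu> i \<notin> X \<Longrightarrow> \<forall>j < Suc i. \<forall>e. b (4 * j + type_code e) = 1 \<longleftrightarrow> e = From \<and> \<nu> j \<in> X"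
proof -
  have less: "b (4 * j + type_code e) = a (4 * j + type_code e)" if "j < i" for j e
    using that by (simp add: b_def pair_index_inject)
  have last: "b (4 * i + type_code e) = 0" for e
    by (cases e) (simp_all add: b_def pair_index_inject)
  show "\<forall>j < Suc i. \<forall>e. (b(4 * i + type_code From := 1)) (4 * j + type_code e) = 1 \<longleftrightarrow>
      e = From \<and> \<nu> j \<in> X" if "\<nu> i \<in> X"
    using that assms(1) less last by (auto simp: less_Suc_eq pair_index_inject)
  show "\<forall>j < Suc i. \<forall>e. b (4 * j + type_code e) = 1 \<longleftrightarrow> e = From \<and> \<nu> j \<in> X" if "\<nu> i \<notin> X"
    using that assms(1) less last by (auto simp: less_Suc_eq)
qed

lemma wp_start_pairs:
  assumes "keeps_separator Z s" and "reg s rTop = 0" and "reg s rAns = 1"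
  shows "wp (for_nodes
       (Store aQ (pair_index rI (Const (type_code To))) (Const 0) ;;
        Store aQ (pair_index rI (Const (type_code From))) (Const 0) ;;
        Store aQ (pair_index rI (Const (type_code Undir))) (Const 0) ;;
        Store aQ (pair_index rI (Const (type_code Bidir))) (Const 0) ;;
        Cond (is_set aX rI)
          (Store aPE (Reg rTop) (Const (type_code From)) ;;
           Store aPT (Reg rTop) (Reg rI) ;;
           inc rTop ;;
           Store aQ (pair_index rI (Const (type_code From))) (Const 1))
          Skip))
    (\<lambda>t s'. t \<le> 100 * n + 6 \<and> keeps_separator Z s' \<and> reg s' rAns = 1 \<and>
      queue s' (set start_pairs) start_pairs) s"
proof -
  define J where "J i s \<longleftrightarrow> keeps_separator Z s \<and> reg s rAns = 1 \<and>
    (\<forall>j < i. \<forall>e. arr s aQ (4 * j + type_code e) = 1 \<longleftrightarrow> e = From \<and> \<nu> j \<in> X) \<and>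
    map (\<lambda>k. (arr s aPE k, arr s aPT k)) [0..<reg s rTop] =
      map (Pair (type_code From)) (filter (\<lambda>j. \<nu> j \<in> X) [0..<i])" for i s
  have N: "reg s rN = n" using assms(1) n_reg by (simp add: keeps_separator_def keeps_def)
  show ?thesis
  proof (rule wp_mono[OF wp_for_nodes[where J = J and K = 92, OF N]])
    show "J 0 (s\<lparr>reg := (reg s)(rI := 0)\<rparr>)"
      using assms by (simp add: J_def keeps_separator_def keeps_def)
  next
    fix i s
    assume i: "i < n" and J: "J i s" and r: "reg s rI = i" "reg s rN = n"
    let ?b = "(arr s aQ)(4 * i + type_code To := 0, 4 * i + type_code From := 0,
      4 * i + type_code Undir := 0, 4 * i + type_code Bidir := 0)"
    note marks = start_marks[of i "arr s aQ"]
    have x: "arr s aX i = (if \<nu> i \<in> X then 1 else 0)"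
      using J i by (simp add: J_def keeps_separator_def keeps_def input_sets)
    show "wp (Store aQ (pair_index rI (Const (type_code To))) (Const 0) ;;
        Store aQ (pair_index rI (Const (type_code From))) (Const 0) ;;
        Store aQ (pair_index rI (Const (type_code Undir))) (Const 0) ;;
        Store aQ (pair_index rI (Const (type_code Bidir))) (Const 0) ;;
        Cond (is_set aX rI)
          (Store aPE (Reg rTop) (Const (type_code From)) ;;
           Store aPT (Reg rTop) (Reg rI) ;;
           inc rTop ;;
           Store aQ (pair_index rI (Const (type_code From))) (Const 1))
          Skip)
       (\<lambda>t s'. t \<le> 92 \<and> reg s' rI = i \<and> reg s' rN = n \<and>
         J (Suc i) (s'\<lparr>reg := (reg s')(rI := Suc i)\<rparr>)) s"
    proof (intro wp_state_rules, goal_cases)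
      case (1 s1 s2 s3 s4 s5 s6 s7 s8)
      have s4: "reg s4 = reg s" "arr s4 = (arr s)(aQ := ?b)"
        using 1(1-8) r by (simp_all add: quadruple)
      have X: "\<nu> i \<in> X" using 1(9) s4 r x by (cases "\<nu> i \<in> X") simp_all
      have s8: "reg s8 = (reg s)(rTop := Suc (reg s rTop))" "arr s8 aQ = ?b(4 * i + type_code From := 1)"
        "arr s8 aPE = (arr s aPE)(reg s rTop := type_code From)"
        "arr s8 aPT = (arr s aPT)(reg s rTop := i)"
        "\<And>b. b \<notin> {aQ, aPE, aPT} \<Longrightarrow> arr s8 b = arr s b"
        using 1(10-17) s4 r by (simp_all add: quadruple)
      let ?s8 = "s8\<lparr>reg := (reg s8)(rI := Suc i)\<rparr>"
      have "map (\<lambda>k. (arr s8 aPE k, arr s8 aPT k)) [0..<reg s rTop] =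
          map (\<lambda>k. (arr s aPE k, arr s aPT k)) [0..<reg s rTop]"
        by (rule map_cong) (simp_all add: s8)
      also have "\<dots> = map (Pair (type_code From)) (filter (\<lambda>j. \<nu> j \<in> X) [0..<i])"
        using J by (simp only: J_def)
      finally have "map (\<lambda>k. (arr s8 aPE k, arr s8 aPT k)) [0..<Suc (reg s rTop)] =
          map (Pair (type_code From)) (filter (\<lambda>j. \<nu> j \<in> X) [0..<i]) @ [(type_code From, i)]"
        by (simp add: s8(3,4))
      then have "map (\<lambda>k. (arr ?s8 aPE k, arr ?s8 aPT k)) [0..<reg ?s8 rTop] =
          map (Pair (type_code From)) (filter (\<lambda>j. \<nu> j \<in> X) [0..<Suc i])"
        using X s8(1) by simp
      moreover have "keeps_separator Z ?s8"
        using J s8 by (simp add: J_def keeps_separator_def keeps_def)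
      moreover have "reg ?s8 rAns = 1" using J s8 by (simp add: J_def)
      moreover have "\<forall>j < Suc i. \<forall>e. arr ?s8 aQ (4 * j + type_code e) = 1 \<longleftrightarrow> e = From \<and> \<nu> j \<in> X"
        using marks(1)[OF _ X] J s8(2) by (simp add: J_def del: fun_upd_apply)
      ultimately have "J (Suc i) ?s8" unfolding J_def by blast
      then show ?case using r s8(1) by simp
    next
      case (2 s1 s2 s3 s4)
      have s4: "reg s4 = reg s" "arr s4 = (arr s)(aQ := ?b)"
        using 2(1-8) r by (simp_all add: quadruple)
      have X: "\<nu> i \<notin> X" using 2(9) s4 r x by (cases "\<nu> i \<in> X") simp_all
      let ?s4 = "s4\<lparr>reg := (reg s4)(rI := Suc i)\<rparr>"
      have "keeps_separator Z ?s4"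
        using J s4 by (simp add: J_def keeps_separator_def keeps_def)
      moreover have "reg ?s4 rAns = 1" "map (\<lambda>k. (arr ?s4 aPE k, arr ?s4 aPT k)) [0..<reg ?s4 rTop] =
          map (Pair (type_code From)) (filter (\<lambda>j. \<nu> j \<in> X) [0..<Suc i])"
        using J X s4 by (simp_all add: J_def)
      moreover have "arr s4 aQ = ?b" using s4 by simp
      then have "\<forall>j < Suc i. \<forall>e. arr ?s4 aQ (4 * j + type_code e) = 1 \<longleftrightarrow> e = From \<and> \<nu> j \<in> X"
        using marks(2)[OF _ X] J by (simp add: J_def del: fun_upd_apply)
      ultimately have "J (Suc i) ?s4" unfolding J_def by blast
      then show ?case using r s4(1) by simp
    qed
  next
    fix t s'
    assume "t \<le> (92 + 8) * n + 6 \<and> reg s' rN = n \<and> J n s'"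
    then show "t \<le> 100 * n + 6 \<and> keeps_separator Z s' \<and> reg s' rAns = 1 \<and>
      queue s' (set start_pairs) start_pairs"
      by (auto simp: J_def queue_def start_pairs_def)
  qed
qed

definition pair_weight :: "edge_type \<times> nat \<Rightarrow> nat" where
  "pair_weight p = 100 + 100 * (off (Suc (snd p)) - off (snd p))"

text \<open>Each node occurs with four edge types, so its list may be scanned four times. The 800 is
  four times 100 for each of the two ends of an edge.\<close>

lemma sum_pair_weight: "sum pair_weight (UNIV \<times> {..<n}) \<le> 400 * n + 800 * num_edges G"
proof -
  have "sum pair_weight (UNIV \<times> {..<n}) = (\<Sum>e\<in>(UNIV :: edge_type set). \<Sum>i<n. pair_weight (e, i))"
    by (simp add: sum.cartesian_product)
  also have "\<dots> = 4 * (\<Sum>i<n. 100 + 100 * (off (Suc i) - off i))"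
    by (simp add: UNIV_edge_type pair_weight_def)
  also have "\<dots> = 400 * n + 400 * (\<Sum>i<n. off (Suc i) - off i)"
    by (simp add: sum.distrib flip: sum_distrib_left)
  finally show ?thesis using sum_deg by linarith
qed

lemma finite_pairs: "finite (UNIV \<times> {..<n} :: (edge_type \<times> nat) set)"
  by (simp add: UNIV_edge_type)

lemma wp_test_sep:
  assumes "keeps_separator Z s"
  shows "wp test_sep_program (\<lambda>t s'. t \<le> 500 * n + 800 * num_edges G + 30 \<and>
    keeps_separator Z s' \<and> (\<exists>b. test_sep G X Y Z b \<and> reg s' rAns = (if b then 1 else 0))) s"
proof -
  let ?loop = "test_sep_loop G Y Z" and ?start = "{From} \<times> X"
  let ?b = "And (Less (Const 0) (Reg rTop)) (Eq (Reg rAns) (Const 1)) :: (register, array) bexp"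
  \<comment> \<open>\<open>test_sep_loop\<close> relates a start to a final result, so progress is
    recorded backwards: every result of the current worklist is a result of the initial one. With
    \<open>rAns = 0\<close> the result is settled and \<open>m\<close> is unconstrained, as no
    further round follows.\<close>
  define Inv where "Inv m s \<longleftrightarrow> keeps_separator Z s \<and>
    (reg s rAns = 0 \<and> ?loop ?start ?start False \<or>
     reg s rAns = 1 \<and> (\<exists>Q st. queue s Q st \<and> sound_queue Q st \<and>
       (\<forall>b. ?loop (name_pairs (set st)) (name_pairs Q) b \<longrightarrow> ?loop ?start ?start b) \<and>
       m = sum pair_weight (UNIV \<times> {..<n} - (Q - set st))))" for m s
  have body: "wp (dec rTop ;; rE ::= Arr aPE (Reg rTop) ;; rT ::= Arr aPT (Reg rTop) ;;
        explore_neighbors ;; Cond (is_set aY rT) (rAns ::= Const 0) Skip)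
      (\<lambda>t s'. \<exists>m'. Inv m' s' \<and> 1 + bcost ?b + t + m' \<le> m) s"
    if inv: "Inv m s" and b: "bval ?b s" for m s
  proof -
    have ks: "keeps_separator Z s" and ans: "reg s rAns = 1" using inv b by (auto simp: Inv_def)
    obtain Q st where m: "queue s Q st" "sound_queue Q st"
      "\<And>b. ?loop (name_pairs (set st)) (name_pairs Q) b \<Longrightarrow> ?loop ?start ?start b"
      "m = sum pair_weight (UNIV \<times> {..<n} - (Q - set st))"
      using inv ans unfolding Inv_def by auto
    obtain top where top: "reg s rTop = Suc top" using b by (cases "reg s rTop") auto
    have len: "length st = Suc top"
      using arg_cong[where f = length, OF conjunct2[OF m(1)[unfolded queue_def]]] top by simp
    then obtain st1 e i where st: "st = st1 @ [(e, i)]"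
      by (cases st rule: rev_cases) auto
    have popped: "arr s aPE top = type_code e" "arr s aPT top = i"
      "map (\<lambda>k. (arr s aPE k, arr s aPT k)) [0..<top] = map (\<lambda>(e, i). (type_code e, i)) st1"
      using m(1) top st by (auto simp: queue_def)
    have eiQ: "(e, i) \<in> Q" "(e, i) \<notin> set st1" and sq: "sound_queue Q st1" and QS: "Q \<subseteq> UNIV \<times> {..<n}"
      using m(2) by (auto simp: sound_queue_def st)
    have i: "i < n" using eiQ QS by auto
    have D: "UNIV \<times> {..<n} - (Q - set st) = insert (e, i) (UNIV \<times> {..<n} - (Q - set st1))"
      using i eiQ by (auto simp: st)
    have w: "m = pair_weight (e, i) + sum pair_weight (UNIV \<times> {..<n} - (Q - set st1))"
      unfolding m(4) D using eiQ finite_pairs by (subst sum.insert) auto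
    let ?s = "s\<lparr>reg := (reg s)(rTop := top, rE := type_code e, rT := i)\<rparr>"
    let ?N = "next_pairs Z e i (off (Suc i))"
    have "keeps_separator Z ?s" "reg ?s rT = i" "reg ?s rE = type_code e" "reg ?s rAns = 1"
      "queue ?s Q st1"
      using ks ans m(1) popped by (auto simp: keeps_separator_def keeps_def queue_def)
    note nb = wp_explore_neighbors[OF this i sq]
    have is_Y: "bval (is_set aY rT) s' \<longleftrightarrow> \<nu> i \<in> Y"
      if "keeps_separator Z s'" "reg s' rT = i" for s'
      using that by (simp add: keeps_separator_def keeps_def input_sets i)
    have eiP: "(e, \<nu> i) \<in> name_pairs (set st)" by (force simp: st name_pairs_def)
    have "name_pairs (set st1) = name_pairs (set st - {(e, i)})" using eiQ by (simp add: st)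
    also have "\<dots> = name_pairs (set st) - {(e, \<nu> i)}"
    proof -
      have "set st \<subseteq> UNIV \<times> {..<n}" using m(2) QS by (auto simp: sound_queue_def)
      from name_pairs_Diff[OF this, of "{(e, i)}"] i show ?thesis
        by (simp add: name_pairs_def)
    qed
    finally have P: "name_pairs (set st1 \<union> (?N - Q)) =
        name_pairs (set st) - {(e, \<nu> i)} \<union> new_pairs G Z (name_pairs Q) e (\<nu> i)"
      by (simp add: name_pairs_Un new_pairs_eq[OF i QS])
    have "Q \<union> ?N = Q \<union> (?N - Q)" by blast
    then have Q: "name_pairs (Q \<union> ?N) = name_pairs Q \<union> new_pairs G Z (name_pairs Q) e (\<nu> i)"
      by (simp only: name_pairs_Un new_pairs_eq[OF i QS])
    show ?thesis
    proof (intro wp_rules, simp add: top popped(1,2), rule wp_mono[OF nb], intro wp_rules, goal_cases)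
      case (1 t s')
      then have ks': "keeps_separator Z s'" "reg s' rT = i" and t: "t \<le> 100 * (off (Suc i) - off i) + 11"
        by blast+
      have "\<nu> i \<in> Y" using 1(2) is_Y[OF ks'] by (simp del: bval.simps)
      \<comment> \<open>The neighbors have already been pushed when \<open>Y\<close> is tested; rule
        \<open>found\<close> disregards them, since only the answer remains of the run. No potential
        has to be left, hence the witness 0 below.\<close>
      then have "?loop ?start ?start False" using m(3) test_sep_loop.found[OF eiP] by blast
      with ks' t show ?case
        by (intro exI[of _ 0] conjI) (simp_all add: Inv_def keeps_separator_def keeps_def w pair_weight_def)
    next
      case (2 t s')
      then obtain st' where ks': "keeps_separator Z s'" "reg s' rT = i" "reg s' rAns = 1"
        and t: "t \<le> 100 * (off (Suc i) - off i) + 11"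
        and q: "queue s' (Q \<union> ?N) st'" "sound_queue (Q \<union> ?N) st'" "set st' = set st1 \<union> (?N - Q)"
        by blast
      have "\<nu> i \<notin> Y" using 2(2) is_Y[OF ks'(1,2)] by (simp del: bval.simps)
      have "?loop ?start ?start b" if "?loop (name_pairs (set st')) (name_pairs (Q \<union> ?N)) b" for b
        using m(3) test_sep_loop.continue[OF eiP \<open>\<nu> i \<notin> Y\<close>] that
        unfolding q(3) P Q by blast
      moreover have "Q \<union> ?N - set st' = Q - set st1" using q(3) sq by (auto simp: sound_queue_def)
      ultimately have "Inv (sum pair_weight (UNIV \<times> {..<n} - (Q - set st1))) s'"
        unfolding Inv_def using ks' q(1,2)
        by (intro conjI disjI2 exI[of _ "Q \<union> ?N"] exI[of _ st'] allI impI) simp_all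
      then show ?case
        by (intro exI[of _ "sum pair_weight (UNIV \<times> {..<n} - (Q - set st1))"] conjI)
          (use t w in \<open>simp_all add: pair_weight_def\<close>)
    qed
  qed
  have final: "\<exists>b. test_sep G X Y Z b \<and> reg s rAns = (if b then 1 else 0)"
    if inv: "Inv m s" and stop: "\<not> bval ?b s" for m s
  proof (cases "reg s rAns = 1")
    case True
    then obtain Q st where q: "queue s Q st"
      "\<And>b. ?loop (name_pairs (set st)) (name_pairs Q) b \<Longrightarrow> ?loop ?start ?start b"
      using inv unfolding Inv_def by auto
    have "reg s rTop = 0" using True stop by simp
    then have "st = []" using q(1) by (simp add: queue_def)
    then have "?loop (name_pairs (set st)) (name_pairs Q) True"
      by (simp add: name_pairs_def test_sep_loop.finished)
    then have "?loop ?start ?start True" using q(2) by blast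
    with True show ?thesis by (intro exI[of _ True]) (simp add: test_sep_def)
  next
    case False
    with inv have "reg s rAns = 0" "?loop ?start ?start False" unfolding Inv_def by blast+
    then show ?thesis by (intro exI[of _ False]) (simp add: test_sep_def)
  qed
  have start: "Inv (sum pair_weight (UNIV \<times> {..<n})) s"
    if "keeps_separator Z s" "reg s rAns = 1" "queue s (set start_pairs) start_pairs" for s
  proof -
    have "sound_queue (set start_pairs) start_pairs"
      by (auto simp: sound_queue_def start_pairs_def distinct_map inj_on_def)
    with that show ?thesis
      unfolding Inv_def
      by (intro conjI disjI2 exI[of _ "set start_pairs"] exI[of _ start_pairs])
        (simp_all add: name_start_pairs)
  qed
  show ?thesis
    unfolding test_sep_program_def explore_neighbors_def[symmetric]
  proof (intro wp_rules, rule wp_mono[OF wp_start_pairs[where Z = Z]], goal_cases)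
    case (4 t1 s1)
    then have "Inv (sum pair_weight (UNIV \<times> {..<n})) s1" using start[of s1] by simp
    then show ?case
    proof (rule wp_mono[OF wp_While[where Inv = Inv, OF _ body]], goal_cases)
      case (3 t2 s2)
      then obtain m where m: "Inv m s2" "\<not> bval ?b s2"
        "t2 + m \<le> sum pair_weight (UNIV \<times> {..<n}) + 1 + bcost ?b" by blast
      have "keeps_separator Z s2" using m(1) unfolding Inv_def by blast
      with final[OF m(1,2)] m(3) sum_pair_weight 4 show ?case by simp
    qed
  qed (use assms in \<open>auto simp: keeps_separator_def keeps_def\<close>)
qed

end

section \<open>The whole program and its running time\<close>

lemma (in encoded_instance) find_sep_program_correct:
  "\<exists>t s' r. exec find_sep_program s0 t s' \<and> t \<le> 1000 * (n + num_edges G) \<and>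
    encodes_output G \<nu> s' r \<and> find_sep G X Y I R r"
proof -
  define Z where "Z = Ant G (X \<union> Y \<union> I) \<inter> (R - (X \<union> Y))"
  \<comment> \<open>The bounds of the three phases add up: 650 is 100 + 50 + 500, 1000 is 200 + 800,
    and 66 is 30 + 6 + 30.\<close>
  have "wp find_sep_program (\<lambda>t s'. t \<le> 650 * n + 1000 * num_edges G + 66 \<and>
      keeps_separator Z s' \<and> (\<exists>b. test_sep G X Y Z b \<and> reg s' rAns = (if b then 1 else 0))) s0"
    unfolding find_sep_program_def
  proof (intro wp_Seq, rule wp_mono[OF wp_anteriors], goal_cases)
    case 1
    then show ?case by (simp add: keeps_def)
  next
    case (2 t1 s1)
    show ?case
    proof (intro wp_Seq, rule wp_mono[OF wp_separator[where A = "Ant G (X \<union> Y \<union> I)"]], goal_cases)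
      case (3 t2 s2)
      then have "keeps_separator Z s2" by (simp add: keeps_separator_def Z_def)
      then show ?case
      proof (rule wp_mono[OF wp_test_sep], goal_cases)
        case (1 t3 s3)
        have "t1 + (t2 + t3) \<le> 650 * n + 1000 * num_edges G + 66"
          using 1 2 3 by linarith
        with 1 show ?case by blast
      qed
    qed (use 2 in blast)+
  qed
  then obtain t s' b where e: "exec find_sep_program s0 t s'"
    and t: "t \<le> 650 * n + 1000 * num_edges G + 66" and Z: "keeps_separator Z s'"
    and b: "test_sep G X Y Z b" "reg s' rAns = (if b then 1 else 0)"
    unfolding wp_def by blast
  have "X \<noteq> {}" "X \<subseteq> verts G" using inst unfolding find_sep_instance_def by blast+
  moreover have "finite (verts G)" using mixed unfolding mixed_graph_def by blast
  \<comment> \<open>With at least one node, \<open>350 * n\<close> absorbs the additive 66.\<close>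
  ultimately have "n > 0" unfolding n_def card_gt_0_iff by blast
  with t have "t \<le> 1000 * (n + num_edges G)" by simp
  moreover have "encodes_output G \<nu> s' (if b then Some Z else None)"
    using b(2) Z by (cases b) (simp_all add: encodes_output_def keeps_separator_def)
  moreover have "find_sep G X Y I R (if b then Some Z else None)"
    unfolding find_sep_def Let_def Z_def[symmetric] using b(1) by blast
  ultimately show ?thesis using e by blast
qed

theorem proposition2:
  shows "\<exists>c. \<forall>(G :: 'v mixed_graph) X Y I R. find_sep_instance G X Y I R \<longrightarrow>
    (\<forall>r. find_sep G X Y I R r \<longrightarrow> find_sep_solution G X Y I R r) \<and>
    (\<forall>\<nu> s. encodes_input G X Y I R \<nu> s \<longrightarrow>
      (\<exists>t s' r. exec find_sep_program s t s' \<and>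
        t \<le> c * (card (verts G) + num_edges G) \<and>
        encodes_output G \<nu> s' r \<and>
        find_sep G X Y I R r \<and>
        find_sep_solution G X Y I R r))"
proof (rule exI[of _ 1000], intro allI impI conjI)
  fix G :: "'v mixed_graph" and X Y I R
  assume inst: "find_sep_instance G X Y I R"
  show "find_sep_solution G X Y I R r" if "find_sep G X Y I R r" for r
    using find_sep_correct[OF inst that] .
  fix \<nu> s
  assume "encodes_input G X Y I R \<nu> s"
  with inst interpret encoded_instance G X Y I R \<nu> s "card (verts G)"
    by unfold_locales simp_all
  show "\<exists>t s' r. exec find_sep_program s t s' \<and>
        t \<le> 1000 * (card (verts G) + num_edges G) \<and>
        encodes_output G \<nu> s' r \<and> find_sep G X Y I R r \<and> find_sep_solution G X Y I R r"
    using find_sep_program_correct find_sep_correct[OF inst] by blast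
qed

end
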